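(* Let $H$ be a finitely generated group and let $A$ be a group (not necessarily finitely generated). Let $\iota^{+},\iota^{-}:A\to H$ be homomorphisms such that both induced maps $$(\iota^{\pm})_{*}:H_{1}(A;\mathbb{Q})\to H_{1}(H;\mathbb{Q})$$ are surjective. Let $G$ be a finitely generated group given by an HNN extension $$G=\ast_{A}H=\langle t,H \mid t^{-1}\iota^{+}(a)t=\iota^{-}(a)\ \ (\forall a\in A)\rangle,$$ and let $\phi:G\to\mathbb{Z}$ be the surjection given by $\phi(t)=1$ and $\phi(h)=0$ for all $h\in H$. If the Alexander polynomial $\Delta_{G}^{\phi}(t)$ has no positive real root, then $G$ is not bi-orderable.
   Context: A bi-ordering on a group $G$ is a total ordering $\leq_G$ on $G$ such that $a\leq_G b$ implies both $ga\leq_G gb$ and $ag\leq_G bg$ for all $a,b,g\in G$. A group is bi-orderable if it admits a bi-ordering. Alexander polynomial: for a finitely generated group $G$ and a surjection $\phi:G\to\mathbb{Z}=\langle t\rangle$, the rational homology $H_1(\ker\phi;\mathbb{Q})$ is a finitely generated $\mathbb{Q}[t,t^{-1}]$-module, where $t$ acts by $t\cdot[x]=[s^{-1}xs]$ for $x\in\ker\phi$ and any $s\in G$ that $\phi$ maps to the generator $t$ of $\mathbb{Z}$. Write $$H_1(\ker\phi;\mathbb{Q})\cong \mathbb{Q}[t,t^{-1}]^{f}\oplus\bigoplus_{i=1}^{n}\mathbb{Q}[t,t^{-1}]/(p_i(t))$$ with $f\geq 0$ and $p_i(t)$ nonzero. Then $\Delta_G^{\phi}(t)=p_1(t)\cdots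 p_n(t)$ if $f=0$, and $\Delta_G^{\phi}(t)=0$ if $f>0$. It is defined up to multiplication by units of $\mathbb{Q}[t,t^{-1}]$.
   Formalization: The formal theorem additionally assumes that ker φ is nontrivial; otherwise G is infinite cyclic (e.g. A = H = 1), its Alexander polynomial is a unit with no positive real root, yet G is bi-orderable, so the statement fails exactly in that case. *)

theory Defs
  imports
    "HOL-Algebra.Algebra"
    "HOL-Algebra.Algebraic_Closure_Type"
    "HOL-Library.Poly_Mapping"
begin

definition finitely_generated_group :: "('a, 'm) monoid_scheme \<Rightarrow> bool" where
  "finitely_generated_group G \<longleftrightarrow>
     (\<exists>S. finite S \<and> S \<subseteq> carrier G \<and> generate G S = carrier G)"

definition bi_ordering :: "('a, 'm) monoid_scheme \<Rightarrow> 'a rel \<Rightarrow> bool" where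
  "bi_ordering G leq \<longleftrightarrow> linear_order_on (carrier G) leq \<and>
     (\<forall>a\<in>carrier G. \<forall>b\<in>carrier G. \<forall>g\<in>carrier G. (a, b) \<in> leq \<longrightarrow>
        (g \<otimes>\<^bsub>G\<^esub> a, g \<otimes>\<^bsub>G\<^esub> b) \<in> leq \<and> (a \<otimes>\<^bsub>G\<^esub> g, b \<otimes>\<^bsub>G\<^esub> g) \<in> leq)"

definition bi_orderable :: "('a, 'm) monoid_scheme \<Rightarrow> bool" where
  "bi_orderable G \<longleftrightarrow> (\<exists>leq. bi_ordering G leq)"


section \<open>The group presented by an HNN extension\<close>

datatype 'h hnn_letter = Base 'h | Stable | StableInv

definition hnn_words :: "('h, 'm) monoid_scheme \<Rightarrow> 'h hnn_letter list set" where
  "hnn_words H = lists (Base ` carrier H \<union> {Stable, StableInv})"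

text \<open>Equality of words in the group generated by \<^term>\<open>H\<close> and a stable letter \<open>t\<close> with the
  relations \<open>t\<^sup>-\<^sup>1 \<iota>\<^sup>+(a) t = \<iota>\<^sup>-(a)\<close>. The maps \<^term>\<open>ip\<close> and \<^term>\<open>im\<close> need not be injective.\<close>

inductive hnn_eq ::
  "('a, 'k) monoid_scheme \<Rightarrow> ('h, 'm) monoid_scheme \<Rightarrow> ('a \<Rightarrow> 'h) \<Rightarrow> ('a \<Rightarrow> 'h) \<Rightarrow>
   'h hnn_letter list \<Rightarrow> 'h hnn_letter list \<Rightarrow> bool"
  for A H ip im where
  word_refl: "w \<in> hnn_words H \<Longrightarrow> hnn_eq A H ip im w w"
| word_sym: "hnn_eq A H ip im v w \<Longrightarrow> hnn_eq A H ip im w v"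
| word_trans: "hnn_eq A H ip im u v \<Longrightarrow> hnn_eq A H ip im v w \<Longrightarrow> hnn_eq A H ip im u w"
| word_append: "hnn_eq A H ip im v v' \<Longrightarrow> hnn_eq A H ip im w w' \<Longrightarrow> hnn_eq A H ip im (v @ w) (v' @ w')"
| base_mult: "x \<in> carrier H \<Longrightarrow> y \<in> carrier H \<Longrightarrow>
    hnn_eq A H ip im [Base x, Base y] [Base (x \<otimes>\<^bsub>H\<^esub> y)]"
| base_one: "hnn_eq A H ip im [Base \<one>\<^bsub>H\<^esub>] []"
| stable_inv: "hnn_eq A H ip im [Stable, StableInv] []"
| inv_stable: "hnn_eq A H ip im [StableInv, Stable] []"
| stable_conj: "a \<in> carrier A \<Longrightarrow> hnn_eq A H ip im [StableInv, Base (ip a), Stable] [Base (im a)]"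

definition hnn_class ::
  "('a, 'k) monoid_scheme \<Rightarrow> ('h, 'm) monoid_scheme \<Rightarrow> ('a \<Rightarrow> 'h) \<Rightarrow> ('a \<Rightarrow> 'h) \<Rightarrow>
   'h hnn_letter list \<Rightarrow> 'h hnn_letter list set" where
  "hnn_class A H ip im w = {v. hnn_eq A H ip im w v}"

definition hnn_extension ::
  "('a, 'k) monoid_scheme \<Rightarrow> ('h, 'm) monoid_scheme \<Rightarrow> ('a \<Rightarrow> 'h) \<Rightarrow> ('a \<Rightarrow> 'h) \<Rightarrow>
   'h hnn_letter list set monoid" where
  "hnn_extension A H ip im =
     \<lparr>carrier = hnn_class A H ip im ` hnn_words H,
      monoid.mult = (\<lambda>U V. {w. \<exists>x\<in>U. \<exists>y\<in>V. hnn_eq A H ip im (x @ y) w}),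
      one = hnn_class A H ip im []\<rparr>"

definition hnn_base ::
  "('a, 'k) monoid_scheme \<Rightarrow> ('h, 'm) monoid_scheme \<Rightarrow> ('a \<Rightarrow> 'h) \<Rightarrow> ('a \<Rightarrow> 'h) \<Rightarrow>
   'h \<Rightarrow> 'h hnn_letter list set" where
  "hnn_base A H ip im x = hnn_class A H ip im [Base x]"

definition hnn_stable ::
  "('a, 'k) monoid_scheme \<Rightarrow> ('h, 'm) monoid_scheme \<Rightarrow> ('a \<Rightarrow> 'h) \<Rightarrow> ('a \<Rightarrow> 'h) \<Rightarrow>
   'h hnn_letter list set" where
  "hnn_stable A H ip im = hnn_class A H ip im [Stable]"

context
  fixes A :: "('a, 'k) monoid_scheme" and H :: "('h, 'm) monoid_scheme" and ip im :: "'a \<Rightarrow> 'h"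
  assumes A: "group A" and H: "group H" and ip: "ip \<in> hom A H" and im: "im \<in> hom A H"
begin

lemma hnn_eq_words: "hnn_eq A H ip im v w \<Longrightarrow> v \<in> hnn_words H \<and> w \<in> hnn_words H"
proof (induction rule: hnn_eq.induct)
  case (stable_conj a)
  then show ?case using ip im by (auto simp: hnn_words_def hom_def)
qed (use H in \<open>auto simp: hnn_words_def group.is_monoid monoid.m_closed monoid.one_closed\<close>)

lemma hnn_class_eq_iff:
  "v \<in> hnn_words H \<Longrightarrow> hnn_class A H ip im v = hnn_class A H ip im w \<longleftrightarrow> hnn_eq A H ip im v w"
  unfolding hnn_class_def by (blast intro: hnn_eq.word_refl hnn_eq.word_sym hnn_eq.word_trans)

lemma hnn_mult_class:
  assumes "v \<in> hnn_words H" "w \<in> hnn_words H"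
  shows "hnn_class A H ip im v \<otimes>\<^bsub>hnn_extension A H ip im\<^esub> hnn_class A H ip im w
         = hnn_class A H ip im (v @ w)"
  unfolding hnn_class_def hnn_extension_def
  using assms by (auto intro: hnn_eq.word_refl hnn_eq.word_trans hnn_eq.word_append)

lemma hnn_letter_inverse:
  assumes "[l] \<in> hnn_words H"
  shows "\<exists>v\<in>hnn_words H. hnn_eq A H ip im (v @ [l]) []"
proof (cases l)
  case (Base x)
  then have x: "x \<in> carrier H" using assms by (auto simp: hnn_words_def)
  interpret H: group H by (fact H)
  have "hnn_eq A H ip im ([Base (inv\<^bsub>H\<^esub> x)] @ [Base x]) []"
    using x
    by (metis H.inv_closed H.l_inv append_Cons append_Nil hnn_eq.base_mult hnn_eq.base_one
        hnn_eq.word_trans)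
  with Base x show ?thesis by (intro bexI[of _ "[Base (inv\<^bsub>H\<^esub> x)]"]) (auto simp: hnn_words_def)
next
  case Stable
  then show ?thesis
    by (intro bexI[of _ "[StableInv]"]) (auto simp: hnn_words_def intro: hnn_eq.inv_stable)
next
  case StableInv
  then show ?thesis
    by (intro bexI[of _ "[Stable]"]) (auto simp: hnn_words_def intro: hnn_eq.stable_inv)
qed

lemma hnn_word_inverse:
  assumes "w \<in> hnn_words H"
  shows "\<exists>v\<in>hnn_words H. hnn_eq A H ip im (v @ w) []"
  using assms
proof (induction w)
  case Nil
  then show ?case by (auto intro: hnn_eq.word_refl)
next
  case (Cons l w)
  then have l: "[l] \<in> hnn_words H" and w: "w \<in> hnn_words H"
    by (auto simp: hnn_words_def)
  obtain v where v: "v \<in> hnn_words H" "hnn_eq A H ip im (v @ w) []"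
    using Cons w by blast
  obtain u where u: "u \<in> hnn_words H" "hnn_eq A H ip im (u @ [l]) []"
    using hnn_letter_inverse[OF l] by blast
  have "hnn_eq A H ip im (v @ (u @ [l]) @ w) (v @ [] @ w)"
    by (intro hnn_eq.word_append hnn_eq.word_refl v u w)
  with v(2) have "hnn_eq A H ip im ((v @ u) @ l # w) []"
    by (auto intro: hnn_eq.word_trans)
  moreover have "v @ u \<in> hnn_words H" using u v by (auto simp: hnn_words_def)
  ultimately show ?case by blast
qed

lemma group_hnn_extension: "group (hnn_extension A H ip im)"
proof (rule groupI)
  let ?G = "hnn_extension A H ip im"
  have car: "carrier ?G = hnn_class A H ip im ` hnn_words H"
    and one: "\<one>\<^bsub>?G\<^esub> = hnn_class A H ip im []"
    by (simp_all add: hnn_extension_def)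
  have nil: "[] \<in> hnn_words H" by (simp add: hnn_words_def)
  have app: "v @ w \<in> hnn_words H" if "v \<in> hnn_words H" "w \<in> hnn_words H" for v w
    using that by (simp add: hnn_words_def)
  show "x \<otimes>\<^bsub>?G\<^esub> y \<in> carrier ?G" if "x \<in> carrier ?G" "y \<in> carrier ?G" for x y
    using that by (auto simp: car hnn_mult_class app)
  show "\<one>\<^bsub>?G\<^esub> \<in> carrier ?G" using nil by (simp add: car one)
  show "x \<otimes>\<^bsub>?G\<^esub> y \<otimes>\<^bsub>?G\<^esub> z = x \<otimes>\<^bsub>?G\<^esub> (y \<otimes>\<^bsub>?G\<^esub> z)"
    if "x \<in> carrier ?G" "y \<in> carrier ?G" "z \<in> carrier ?G" for x y z
    using that by (auto simp: car hnn_mult_class app)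
  show "\<one>\<^bsub>?G\<^esub> \<otimes>\<^bsub>?G\<^esub> x = x" if "x \<in> carrier ?G" for x
    using that by (auto simp: car one hnn_mult_class nil)
  show "\<exists>y\<in>carrier ?G. y \<otimes>\<^bsub>?G\<^esub> x = \<one>\<^bsub>?G\<^esub>" if "x \<in> carrier ?G" for x
    using that hnn_word_inverse by (auto simp: car one hnn_mult_class hnn_class_eq_iff app)
qed

lemma hnn_base_hom: "hnn_base A H ip im \<in> hom H (hnn_extension A H ip im)"
proof (rule homI)
  fix x assume "x \<in> carrier H"
  then show "hnn_base A H ip im x \<in> carrier (hnn_extension A H ip im)"
    by (auto simp: hnn_base_def hnn_extension_def hnn_words_def)
next
  fix x y assume "x \<in> carrier H" "y \<in> carrier H"
  moreover from this have "[Base x] \<in> hnn_words H" "[Base y] \<in> hnn_words H"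
      "[Base (x \<otimes>\<^bsub>H\<^esub> y)] \<in> hnn_words H"
    using group.is_monoid[OF H] by (auto simp: hnn_words_def monoid.m_closed)
  ultimately show "hnn_base A H ip im (x \<otimes>\<^bsub>H\<^esub> y) =
      hnn_base A H ip im x \<otimes>\<^bsub>hnn_extension A H ip im\<^esub> hnn_base A H ip im y"
    unfolding hnn_base_def
    by (simp add: hnn_mult_class hnn_class_eq_iff hnn_eq.word_sym[OF hnn_eq.base_mult])
qed

lemma hnn_stable_carrier: "hnn_stable A H ip im \<in> carrier (hnn_extension A H ip im)"
  by (simp add: hnn_stable_def hnn_extension_def hnn_words_def)

lemma hnn_inv_stable:
  "inv\<^bsub>hnn_extension A H ip im\<^esub> hnn_stable A H ip im = hnn_class A H ip im [StableInv]"
proof -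
  interpret G: group "hnn_extension A H ip im" by (rule group_hnn_extension)
  have w: "[StableInv] \<in> hnn_words H" "[Stable] \<in> hnn_words H"
    "[StableInv, Stable] \<in> hnn_words H"
    by (simp_all add: hnn_words_def)
  show ?thesis
  proof (rule G.inv_equality)
    show "hnn_class A H ip im [StableInv] \<otimes>\<^bsub>hnn_extension A H ip im\<^esub> hnn_stable A H ip im =
        \<one>\<^bsub>hnn_extension A H ip im\<^esub>"
      using w hnn_eq.inv_stable[of A H ip im]
      by (simp add: hnn_stable_def hnn_mult_class hnn_class_eq_iff)
        (simp add: hnn_extension_def hnn_class_eq_iff)
    show "hnn_stable A H ip im \<in> carrier (hnn_extension A H ip im)"
      by (rule hnn_stable_carrier)
    show "hnn_class A H ip im [StableInv] \<in> carrier (hnn_extension A H ip im)"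
      using w by (simp add: hnn_extension_def)
  qed
qed

lemma hnn_relation:
  assumes "a \<in> carrier A"
  shows "inv\<^bsub>hnn_extension A H ip im\<^esub> hnn_stable A H ip im
      \<otimes>\<^bsub>hnn_extension A H ip im\<^esub> hnn_base A H ip im (ip a)
      \<otimes>\<^bsub>hnn_extension A H ip im\<^esub> hnn_stable A H ip im = hnn_base A H ip im (im a)"
proof -
  have "ip a \<in> carrier H" using assms ip by (auto simp: hom_def)
  then have w: "[StableInv] \<in> hnn_words H" "[Stable] \<in> hnn_words H" "[Base (ip a)] \<in> hnn_words H"
    "[StableInv, Base (ip a)] \<in> hnn_words H" "[StableInv, Base (ip a), Stable] \<in> hnn_words H"
    by (simp_all add: hnn_words_def)
  have "inv\<^bsub>hnn_extension A H ip im\<^esub> hnn_stable A H ip im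
      \<otimes>\<^bsub>hnn_extension A H ip im\<^esub> hnn_base A H ip im (ip a)
      \<otimes>\<^bsub>hnn_extension A H ip im\<^esub> hnn_stable A H ip im
      = hnn_class A H ip im [StableInv, Base (ip a), Stable]"
    using w unfolding hnn_inv_stable by (simp add: hnn_base_def hnn_stable_def hnn_mult_class)
  also have "\<dots> = hnn_base A H ip im (im a)"
    unfolding hnn_base_def using w hnn_eq.stable_conj[OF assms] by (simp add: hnn_class_eq_iff)
  finally show ?thesis .
qed

lemma hnn_universal:
  fixes L :: "('l, 'n) monoid_scheme"
  assumes L: "group L" and f: "f \<in> hom H L" and u: "u \<in> carrier L"
    and rel: "\<And>a. a \<in> carrier A \<Longrightarrow> inv\<^bsub>L\<^esub> u \<otimes>\<^bsub>L\<^esub> f (ip a) \<otimes>\<^bsub>L\<^esub> u = f (im a)"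
  shows "\<exists>g\<in>hom (hnn_extension A H ip im) L.
    g (hnn_stable A H ip im) = u \<and> (\<forall>h\<in>carrier H. g (hnn_base A H ip im h) = f h)"
proof -
  interpret L: group L by (fact L)
  interpret H: group H by (fact H)
  define ev where "ev l = (case l of Base x \<Rightarrow> f x | Stable \<Rightarrow> u | StableInv \<Rightarrow> inv\<^bsub>L\<^esub> u)" for l
  define evw where "evw w = foldr (\<lambda>l y. ev l \<otimes>\<^bsub>L\<^esub> y) w \<one>\<^bsub>L\<^esub>" for w
  have fc: "f x \<in> carrier L" if "x \<in> carrier H" for x using f that by (auto simp: hom_def)
  have evw_c: "evw w \<in> carrier L" if "w \<in> hnn_words H" for w
    using that unfolding hnn_words_def
    by (induction w) (auto simp: evw_def ev_def fc u)
  have evw_app: "evw (v @ w) = evw v \<otimes>\<^bsub>L\<^esub> evw w" if "v \<in> hnn_words H" "w \<in> hnn_words H" for v w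
    using that
  proof (induction v)
    case Nil then show ?case using evw_c by (simp add: evw_def)
  next
    case (Cons l v)
    then have v: "v \<in> hnn_words H" and l: "ev l \<in> carrier L" by (auto simp: hnn_words_def ev_def fc u)
    have "evw ((l # v) @ w) = ev l \<otimes>\<^bsub>L\<^esub> (evw v \<otimes>\<^bsub>L\<^esub> evw w)" using Cons v by (simp add: evw_def)
    then show ?case using v l Cons.prems evw_c L.m_assoc by (simp add: evw_def)
  qed
  have f1: "f \<one>\<^bsub>H\<^esub> = \<one>\<^bsub>L\<^esub>" using f H L by (simp add: hom_one)
  have inv: "evw v = evw w" if "hnn_eq A H ip im v w" for v w
    using that
  proof (induction rule: hnn_eq.induct)
    case (word_append v v' w w')
    then show ?case using hnn_eq_words evw_app by metis
  next
    case (base_mult x y)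
    then show ?case using f by (simp add: evw_def ev_def hom_mult fc)
  next
    case (stable_conj a)
    moreover have "ip a \<in> carrier H" "im a \<in> carrier H" using stable_conj ip im by (auto simp: hom_def)
    ultimately show ?case using rel[of a] u by (simp add: evw_def ev_def fc L.m_assoc[symmetric] del: L.m_assoc)
  qed (auto simp: evw_def ev_def u f1)
  define g where "g Z = the_elem (evw ` Z)" for Z
  have g: "g (hnn_class A H ip im w) = evw w" if "w \<in> hnn_words H" for w
  proof -
    have "evw ` hnn_class A H ip im w = {evw w}"
      using that inv unfolding hnn_class_def by (auto intro: hnn_eq.word_refl simp: image_iff)
    then show ?thesis by (simp add: g_def)
  qed
  show ?thesis
  proof (intro bexI conjI ballI)
    show "g (hnn_stable A H ip im) = u"
      unfolding hnn_stable_def using g u by (simp add: hnn_words_def evw_def ev_def)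
    show "g (hnn_base A H ip im h) = f h" if "h \<in> carrier H" for h
      unfolding hnn_base_def using that g fc by (simp add: hnn_words_def evw_def ev_def)
    show "g \<in> hom (hnn_extension A H ip im) L"
    proof (rule homI)
      fix x assume "x \<in> carrier (hnn_extension A H ip im)"
      then show "g x \<in> carrier L" using g evw_c by (auto simp: hnn_extension_def)
    next
      fix x y assume "x \<in> carrier (hnn_extension A H ip im)" "y \<in> carrier (hnn_extension A H ip im)"
      then obtain v w where vw: "v \<in> hnn_words H" "w \<in> hnn_words H"
        "x = hnn_class A H ip im v" "y = hnn_class A H ip im w" by (auto simp: hnn_extension_def)
      then have "v @ w \<in> hnn_words H" by (simp add: hnn_words_def)
      then show "g (x \<otimes>\<^bsub>hnn_extension A H ip im\<^esub> y) = g x \<otimes>\<^bsub>L\<^esub> g y"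
        using vw g evw_app by (simp add: hnn_mult_class)
    qed
  qed
qed

end


section \<open>First rational homology of a group\<close>

text \<open>The complex \<open>\<rat>[G\<^sup>2] \<rightarrow> \<rat>[G] \<rightarrow> \<rat>\<close> of inhomogeneous (bar) chains with trivial coefficients:
  \<open>d\<^sub>2[x|y] = [y] - [xy] + [x]\<close> and \<open>d\<^sub>1 = 0\<close>, so every 1-chain is a cycle. Chains are finitely
  supported functions with support in the carrier.\<close>

definition chain_group :: "('a, 'm) monoid_scheme \<Rightarrow> ('a \<Rightarrow>\<^sub>0 rat) monoid" where
  "chain_group G = \<lparr>carrier = {c. Poly_Mapping.keys c \<subseteq> carrier G}, monoid.mult = (+), one = 0\<rparr>"

definition bar_boundary :: "('a, 'm) monoid_scheme \<Rightarrow> ('a \<times> 'a \<Rightarrow>\<^sub>0 rat) \<Rightarrow> ('a \<Rightarrow>\<^sub>0 rat)" where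
  "bar_boundary G c = (\<Sum>(x, y)\<in>Poly_Mapping.keys c. Poly_Mapping.single y (Poly_Mapping.lookup c (x, y))
     - Poly_Mapping.single (x \<otimes>\<^bsub>G\<^esub> y) (Poly_Mapping.lookup c (x, y)) + Poly_Mapping.single x (Poly_Mapping.lookup c (x, y)))"

definition boundaries :: "('a, 'm) monoid_scheme \<Rightarrow> ('a \<Rightarrow>\<^sub>0 rat) set" where
  "boundaries G = bar_boundary G ` {c. Poly_Mapping.keys c \<subseteq> carrier G \<times> carrier G}"

definition H1_group :: "('a, 'm) monoid_scheme \<Rightarrow> ('a \<Rightarrow>\<^sub>0 rat) set monoid" where
  "H1_group G = chain_group G Mod boundaries G"

definition H1_class :: "('a, 'm) monoid_scheme \<Rightarrow> ('a \<Rightarrow>\<^sub>0 rat) \<Rightarrow> ('a \<Rightarrow>\<^sub>0 rat) set" where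
  "H1_class G c = boundaries G #>\<^bsub>chain_group G\<^esub> c"

definition chain_map :: "('a \<Rightarrow> 'b) \<Rightarrow> ('a \<Rightarrow>\<^sub>0 rat) \<Rightarrow> ('b \<Rightarrow>\<^sub>0 rat)" where
  "chain_map f c = (\<Sum>x\<in>Poly_Mapping.keys c. Poly_Mapping.single (f x) (Poly_Mapping.lookup c x))"

text \<open>The map induced on homology by a homomorphism \<^term>\<open>f\<close> into \<^term>\<open>H\<close>; the class of
  \<^term>\<open>chain_map f c\<close> is the same for all representatives \<^term>\<open>c\<close> of \<^term>\<open>u\<close>.\<close>

definition H1_map ::
  "('b, 'm) monoid_scheme \<Rightarrow> ('a \<Rightarrow> 'b) \<Rightarrow> ('a \<Rightarrow>\<^sub>0 rat) set \<Rightarrow> ('b \<Rightarrow>\<^sub>0 rat) set" where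
  "H1_map H f u = the_elem ((\<lambda>c. H1_class H (chain_map f c)) ` u)"


section \<open>Laurent polynomials and their modules\<close>

text \<open>\<open>\<rat>[t,t\<^sup>-\<^sup>1]\<close> is the monoid algebra of the additive monoid of integers; multiplication of
  finitely supported functions is convolution.\<close>

type_synonym laurent = "int \<Rightarrow>\<^sub>0 rat"

abbreviation laurent_ring :: "laurent ring" where
  "laurent_ring \<equiv> ring_of_type_algebra"

definition laurent_eval :: "laurent \<Rightarrow> real \<Rightarrow> real" where
  "laurent_eval p x = (\<Sum>k\<in>Poly_Mapping.keys p. of_rat (Poly_Mapping.lookup p k) * x powi k)"

text \<open>The fields \<^const>\<open>monoid.mult\<close> and \<^const>\<open>one\<close> of a module record carry no information.\<close>

definition laurent_regular :: "(laurent, laurent) module" where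
  "laurent_regular =
     \<lparr>carrier = UNIV, monoid.mult = undefined, one = undefined, ring.zero = 0, ring.add = (+), module.smult = (*)\<rparr>"

definition laurent_cyclic :: "laurent \<Rightarrow> (laurent, laurent set) module" where
  "laurent_cyclic p =
     (let I = PIdl\<^bsub>laurent_ring\<^esub> p; Q = laurent_ring Quot I in
      \<lparr>carrier = carrier Q, monoid.mult = undefined, one = undefined, ring.zero = \<zero>\<^bsub>Q\<^esub>, ring.add = ring.add Q,
       module.smult = (\<lambda>r u. (I +>\<^bsub>laurent_ring\<^esub> r) \<otimes>\<^bsub>Q\<^esub> u)\<rparr>)"

text \<open>The product over an index set; it is the direct sum when the set is finite.\<close>

definition module_product :: "'i set \<Rightarrow> ('i \<Rightarrow> ('r, 'b) module) \<Rightarrow> ('r, 'i \<Rightarrow> 'b) module" where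
  "module_product I M =
     \<lparr>carrier = (\<Pi>\<^sub>E i\<in>I. carrier (M i)), monoid.mult = undefined, one = undefined,
      ring.zero = (\<lambda>i\<in>I. \<zero>\<^bsub>M i\<^esub>), ring.add = (\<lambda>u v. \<lambda>i\<in>I. u i \<oplus>\<^bsub>M i\<^esub> v i),
      module.smult = (\<lambda>r u. \<lambda>i\<in>I. r \<odot>\<^bsub>M i\<^esub> u i)\<rparr>"

definition module_sum :: "('r, 'b) module \<Rightarrow> ('r, 'c) module \<Rightarrow> ('r, 'b \<times> 'c) module" where
  "module_sum M N =
     \<lparr>carrier = carrier M \<times> carrier N, monoid.mult = undefined, one = undefined,
      ring.zero = (\<zero>\<^bsub>M\<^esub>, \<zero>\<^bsub>N\<^esub>), ring.add = (\<lambda>(u, v) (u', v'). (u \<oplus>\<^bsub>M\<^esub> u', v \<oplus>\<^bsub>N\<^esub> v')),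
      module.smult = (\<lambda>r (u, v). (r \<odot>\<^bsub>M\<^esub> u, r \<odot>\<^bsub>N\<^esub> v))\<rparr>"

definition module_isomorphic :: "'r ring \<Rightarrow> ('r, 'b) module \<Rightarrow> ('r, 'c) module \<Rightarrow> bool" where
  "module_isomorphic R M N \<longleftrightarrow>
     (\<exists>h. bij_betw h (carrier M) (carrier N) \<and>
        (\<forall>x\<in>carrier M. \<forall>y\<in>carrier M. h (x \<oplus>\<^bsub>M\<^esub> y) = h x \<oplus>\<^bsub>N\<^esub> h y) \<and>
        (\<forall>r\<in>carrier R. \<forall>x\<in>carrier M. h (r \<odot>\<^bsub>M\<^esub> x) = r \<odot>\<^bsub>N\<^esub> h x))"


section \<open>The Alexander polynomial\<close>

abbreviation kernel_group :: "('a, 'm) monoid_scheme \<Rightarrow> ('a \<Rightarrow> int) \<Rightarrow> ('a, 'm) monoid_scheme" where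
  "kernel_group G \<phi> \<equiv> G\<lparr>carrier := kernel G integer_group \<phi>\<rparr>"

text \<open>\<open>(\<Sum>\<^sub>k p\<^sub>k t\<^sup>k) \<cdot> (\<Sum>\<^sub>x c\<^sub>x [x]) = \<Sum>\<^sub>k \<Sum>\<^sub>x p\<^sub>k c\<^sub>x [s\<^sup>-\<^sup>k x s\<^sup>k]\<close>\<close>

definition laurent_act ::
  "('a, 'm) monoid_scheme \<Rightarrow> 'a \<Rightarrow> laurent \<Rightarrow> ('a \<Rightarrow>\<^sub>0 rat) \<Rightarrow> ('a \<Rightarrow>\<^sub>0 rat)" where
  "laurent_act G s p c = (\<Sum>k\<in>Poly_Mapping.keys p. \<Sum>x\<in>Poly_Mapping.keys c.
     Poly_Mapping.single (inv\<^bsub>G\<^esub> (s [^]\<^bsub>G\<^esub> k) \<otimes>\<^bsub>G\<^esub> x \<otimes>\<^bsub>G\<^esub> (s [^]\<^bsub>G\<^esub> k)) (Poly_Mapping.lookup p k * Poly_Mapping.lookup c x))"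

text \<open>\<open>H\<^sub>1(ker \<phi>; \<rat>)\<close> as a module over \<open>\<rat>[t,t\<^sup>-\<^sup>1]\<close>, where \<^term>\<open>s\<close> is an element of \<^term>\<open>G\<close> with
  \<^term>\<open>\<phi> s = 1\<close>; the module structure does not depend on the choice of \<^term>\<open>s\<close>.\<close>

definition alexander_module ::
  "('a, 'm) monoid_scheme \<Rightarrow> ('a \<Rightarrow> int) \<Rightarrow> 'a \<Rightarrow> (laurent, ('a \<Rightarrow>\<^sub>0 rat) set) module" where
  "alexander_module G \<phi> s =
     (let K = kernel_group G \<phi> in
      \<lparr>carrier = carrier (H1_group K), monoid.mult = undefined, one = undefined,
       ring.zero = \<one>\<^bsub>H1_group K\<^esub>, ring.add = monoid.mult (H1_group K),
       module.smult = (\<lambda>p u. the_elem ((\<lambda>c. H1_class K (laurent_act G s p c)) ` u))\<rparr>)"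

text \<open>The Alexander polynomial is only defined up to units, so it is rendered as the relation
  that \<^term>\<open>\<Delta>\<close> is one of its representatives. As the \<^term>\<open>p i\<close> may be multiplied by units, and
  units may be added as further factors, all unit multiples are representatives as well.\<close>

definition alexander_polynomial ::
  "('a, 'm) monoid_scheme \<Rightarrow> ('a \<Rightarrow> int) \<Rightarrow> laurent \<Rightarrow> bool" where
  "alexander_polynomial G \<phi> \<Delta> \<longleftrightarrow>
     (\<exists>s\<in>carrier G. \<phi> s = 1 \<and>
       (\<exists>(f::nat) (n::nat) p. (\<forall>i<n. p i \<noteq> 0) \<and>
          module_isomorphic laurent_ring (alexander_module G \<phi> s)
            (module_sum (module_product {..<f} (\<lambda>_. laurent_regular))
                        (module_product {..<n} (\<lambda>i. laurent_cyclic (p i)))) \<and>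
          \<Delta> = (if f = 0 then (\<Prod>i<n. p i) else 0)))"

end

theory Submission
  imports Defs
begin

text \<open>Suppose \<open>G\<close> is bi-ordered and let \<open>x\<close> be the largest of the generators of the image of \<open>H\<close> and
  their inverses. Comparing powers with powers of \<open>x\<close> defines an order-preserving homomorphism \<open>\<tau>\<close> to
  \<open>\<real>\<close> on the convex subgroup \<open>C\<close> spanned by \<open>x\<close>, with \<open>\<tau> x = 1\<close>. As \<open>\<iota>\<^sup>+\<close> and \<open>\<iota>\<^sup>-\<close> are surjective on
  rational homology, \<open>\<tau>\<close> does not vanish on \<open>\<iota>\<^sup>\<plusminus>(A)\<close>; since \<open>\<iota>\<^sup>-(A) = t\<^sup>-\<^sup>1 \<iota>\<^sup>+(A) t\<close>, this forces
  \<open>t\<^sup>-\<^sup>1 C t = C\<close>, and therefore \<open>ker \<phi> \<subseteq> C\<close>. An order-preserving homomorphism to \<open>\<real>\<close> is unique up to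
  scaling, so \<open>\<tau> (t\<^sup>-\<^sup>1 y t) = r \<cdot> \<tau> y\<close> on \<open>ker \<phi>\<close> for some \<open>r > 0\<close>. The functional on \<open>H\<^sub>1(ker \<phi>; \<rat>)\<close> induced
  by \<open>\<tau>\<close> turns the action of a Laurent polynomial \<open>p\<close> into multiplication by \<open>p(r)\<close>. If the free rank is
  \<open>0\<close>, then \<open>\<Delta>\<close> annihilates the module, so \<open>\<Delta>(r) = 0\<close>; otherwise \<open>\<Delta> = 0\<close>.\<close>

section \<open>Bi-ordered groups\<close>

text \<open>By the Archimedean property a nonzero gap has unbounded multiples. This turns estimates
  on \<open>n\<close>-th powers with an error independent of \<open>n\<close> into exact
  equalities.\<close>

lemma eq_if_nat_multiples_close:
  fixes a b c :: real
  assumes "\<And>n::nat. \<bar>real n * a - real n * b\<bar> \<le> c"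
  shows "a = b"
proof (rule ccontr)
  assume "a \<noteq> b"
  then obtain n where "c < real n * \<bar>a - b\<bar>"
    using reals_Archimedean3[of "\<bar>a - b\<bar>"] by auto
  moreover have "real n * \<bar>a - b\<bar> = \<bar>real n * a - real n * b\<bar>"
    by (simp add: right_diff_distrib[symmetric] abs_mult)
  ultimately show False using assms[of n] by simp
qed

locale bi_ordered_group = group G for G :: "('a, 'm) monoid_scheme" (structure) +
  fixes leq :: "'a rel"
  assumes bi_ordering: "bi_ordering G leq"
begin

abbreviation le :: "'a \<Rightarrow> 'a \<Rightarrow> bool" (infix \<open>\<sqsubseteq>\<close> 50) where
  "x \<sqsubseteq> y \<equiv> (x, y) \<in> leq"

lemma le_carrier: "x \<sqsubseteq> y \<Longrightarrow> x \<in> carrier G" "x \<sqsubseteq> y \<Longrightarrow> y \<in> carrier G"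
  and le_refl: "x \<in> carrier G \<Longrightarrow> x \<sqsubseteq> x"
  and le_trans: "x \<sqsubseteq> y \<Longrightarrow> y \<sqsubseteq> z \<Longrightarrow> x \<sqsubseteq> z"
  and le_antisym: "x \<sqsubseteq> y \<Longrightarrow> y \<sqsubseteq> x \<Longrightarrow> x = y"
  and le_total: "x \<in> carrier G \<Longrightarrow> y \<in> carrier G \<Longrightarrow> x \<sqsubseteq> y \<or> y \<sqsubseteq> x"
proof -
  have o: "leq \<subseteq> carrier G \<times> carrier G" "\<forall>x\<in>carrier G. x \<sqsubseteq> x" "trans leq" "antisym leq"
    "\<forall>x\<in>carrier G. \<forall>y\<in>carrier G. x \<noteq> y \<longrightarrow> x \<sqsubseteq> y \<or> y \<sqsubseteq> x"
    using bi_ordering unfolding bi_ordering_def order_on_defs by (auto simp: refl_on_def total_on_def)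
  show "x \<sqsubseteq> y \<Longrightarrow> x \<in> carrier G" "x \<sqsubseteq> y \<Longrightarrow> y \<in> carrier G" using o(1) by auto
  show "x \<in> carrier G \<Longrightarrow> x \<sqsubseteq> x" using o(2) by blast
  show "x \<sqsubseteq> y \<Longrightarrow> y \<sqsubseteq> z \<Longrightarrow> x \<sqsubseteq> z" using o(3) by (rule transD)
  show "x \<sqsubseteq> y \<Longrightarrow> y \<sqsubseteq> x \<Longrightarrow> x = y" using o(4) by (rule antisymD)
  show "x \<in> carrier G \<Longrightarrow> y \<in> carrier G \<Longrightarrow> x \<sqsubseteq> y \<or> y \<sqsubseteq> x" using o(2,5) by metis
qed

lemma mult_mono:
  assumes "x \<sqsubseteq> y" "u \<sqsubseteq> v"
  shows "x \<otimes> u \<sqsubseteq> y \<otimes> v"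
proof -
  have "x \<otimes> u \<sqsubseteq> y \<otimes> u" "y \<otimes> u \<sqsubseteq> y \<otimes> v"
    using assms bi_ordering unfolding bi_ordering_def by (simp_all add: le_carrier)
  then show ?thesis by (rule le_trans)
qed

lemma conj_mono:
  assumes "x \<sqsubseteq> y" "g \<in> carrier G"
  shows "inv g \<otimes> x \<otimes> g \<sqsubseteq> inv g \<otimes> y \<otimes> g"
  using assms by (intro mult_mono le_refl) auto

lemma inv_antimono:
  assumes "x \<sqsubseteq> y"
  shows "inv y \<sqsubseteq> inv x"
proof -
  have c: "x \<in> carrier G" "y \<in> carrier G" using assms le_carrier by auto
  then have "inv x \<otimes> x \<otimes> inv y \<sqsubseteq> inv x \<otimes> y \<otimes> inv y"
    using assms by (intro mult_mono le_refl) auto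
  with c show ?thesis by (simp add: m_assoc)
qed

lemma nat_pow_mono:
  assumes "x \<sqsubseteq> y"
  shows "x [^] (n::nat) \<sqsubseteq> y [^] n"
  by (induction n) (auto intro: mult_mono assms le_refl)

lemma int_pow_mono:
  assumes "\<one> \<sqsubseteq> x" "m \<le> (n::int)"
  shows "x [^] m \<sqsubseteq> x [^] n"
proof -
  have c: "x \<in> carrier G" using assms le_carrier by auto
  have "x [^] m \<otimes> \<one> [^] nat (n - m) \<sqsubseteq> x [^] m \<otimes> x [^] nat (n - m)"
    using c by (intro mult_mono nat_pow_mono assms le_refl) auto
  also have "x [^] m \<otimes> x [^] nat (n - m) = x [^] (m + int (nat (n - m)))"
    using c by (simp only: int_pow_mult int_pow_int)
  finally show ?thesis using assms c by simp
qed

text \<open>If \<open>m\<close> exceeded \<open>n\<close>, then \<open>x [^] (n + 1)\<close> would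
  lie below \<open>x [^] n\<close>, and cancelling would put \<open>x\<close> below the identity.
  Exponents can therefore be read off from inequalities between powers.\<close>

lemma int_pow_le_imp_le:
  assumes "\<one> \<sqsubseteq> x" "x \<noteq> \<one>" "x [^] m \<sqsubseteq> x [^] (n::int)"
  shows "m \<le> n"
proof (rule ccontr)
  assume "\<not> m \<le> n"
  then have "x [^] (n + 1) \<sqsubseteq> x [^] m" by (intro int_pow_mono assms) auto
  with assms have "x [^] (n + 1) \<sqsubseteq> x [^] n" by (blast intro: le_trans)
  have c: "x \<in> carrier G" using assms le_carrier by auto
  have "inv (x [^] n) \<otimes> x [^] (n + 1) \<sqsubseteq> inv (x [^] n) \<otimes> x [^] n"
    using c \<open>x [^] (n + 1) \<sqsubseteq> x [^] n\<close> by (intro mult_mono le_refl) auto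
  then have "x \<sqsubseteq> \<one>" using c by (simp add: int_pow_mult m_assoc[symmetric])
  with assms show False using le_antisym by blast
qed

section \<open>Convex subgroups generated by one element\<close>

text \<open>For \<open>x\<close> in the group this is the smallest convex subgroup containing
  \<open>x\<close>. Arbitrary integer exponents on both sides make it indifferent to whether
  \<open>x\<close> lies above or below the identity.\<close>

definition convex_span :: "'a \<Rightarrow> 'a set" where
  "convex_span x = {y. \<exists>(m::int) (n::int). x [^] m \<sqsubseteq> y \<and> y \<sqsubseteq> x [^] n}"

lemma convex_span_self: "x \<in> carrier G \<Longrightarrow> x \<in> convex_span x"
  unfolding convex_span_def by (auto intro!: exI[of _ "1::int"] le_refl)

lemma convex_span_convex: "a \<in> convex_span x \<Longrightarrow> b \<in> convex_span x \<Longrightarrow> a \<sqsubseteq> y \<Longrightarrow> y \<sqsubseteq> b \<Longrightarrow> y \<in> convex_span x"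
  unfolding convex_span_def by (blast intro: le_trans)

lemma subgroup_convex_span:
  assumes "x \<in> carrier G"
  shows "subgroup (convex_span x) G"
proof (rule subgroupI)
  show "convex_span x \<subseteq> carrier G" by (auto simp: convex_span_def le_carrier)
  show "convex_span x \<noteq> {}" using convex_span_self assms by auto
next
  fix y assume "y \<in> convex_span x"
  then obtain m n :: int where "x [^] m \<sqsubseteq> y" "y \<sqsubseteq> x [^] n" by (auto simp: convex_span_def)
  then have "x [^] (-n) \<sqsubseteq> inv y \<and> inv y \<sqsubseteq> x [^] (-m)"
    using assms by (simp add: int_pow_neg inv_antimono)
  then show "inv y \<in> convex_span x" unfolding convex_span_def by blast
next
  fix y z assume "y \<in> convex_span x" "z \<in> convex_span x"
  then obtain m n m' n' :: int where
    "x [^] m \<sqsubseteq> y" "y \<sqsubseteq> x [^] n" "x [^] m' \<sqsubseteq> z" "z \<sqsubseteq> x [^] n'" by (auto simp: convex_span_def)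
  then have "x [^] (m + m') \<sqsubseteq> y \<otimes> z \<and> y \<otimes> z \<sqsubseteq> x [^] (n + n')"
    using assms by (simp add: int_pow_mult mult_mono)
  then show "y \<otimes> z \<in> convex_span x" unfolding convex_span_def by blast
qed

lemma convex_span_mono:
  assumes "x \<in> carrier G" "y \<in> convex_span x"
  shows "convex_span y \<subseteq> convex_span x"
proof
  fix z assume "z \<in> convex_span y"
  then obtain m n :: int where "y [^] m \<sqsubseteq> z" "z \<sqsubseteq> y [^] n" by (auto simp: convex_span_def)
  then show "z \<in> convex_span x"
    using subgroup_int_pow_closed[OF subgroup_convex_span] assms by (blast intro: convex_span_convex)
qed

lemma conj_int_pow:
  assumes "x \<in> carrier G" "g \<in> carrier G"
  shows "inv g \<otimes> x [^] (k::int) \<otimes> g = (inv g \<otimes> x \<otimes> g) [^] k"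
proof -
  have "g \<otimes> (inv g \<otimes> z) = z" if "z \<in> carrier G" for z
    using assms(2) that by (simp add: m_assoc[symmetric])
  then have "group_hom G G (\<lambda>x. inv g \<otimes> x \<otimes> g)"
    using assms(2) by unfold_locales (auto intro!: homI simp: m_assoc)
  then show ?thesis using group_hom.hom_int_pow assms(1) by metis
qed

lemma conj_convex_span:
  assumes "x \<in> carrier G" "g \<in> carrier G" "y \<in> convex_span x"
  shows "inv g \<otimes> y \<otimes> g \<in> convex_span (inv g \<otimes> x \<otimes> g)"
proof -
  obtain m n :: int where "x [^] m \<sqsubseteq> y" "y \<sqsubseteq> x [^] n" using assms by (auto simp: convex_span_def)
  then have "inv g \<otimes> x [^] m \<otimes> g \<sqsubseteq> inv g \<otimes> y \<otimes> g" "inv g \<otimes> y \<otimes> g \<sqsubseteq> inv g \<otimes> x [^] n \<otimes> g"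
    using assms conj_mono by auto
  then show ?thesis unfolding convex_span_def conj_int_pow[OF assms(1,2)] by blast
qed

text \<open>Convex spans of two elements are nested, so the largest of the given elements and their
  inverses serves for all of them. That it can be found inside \<open>N\<close> matters later, where
  \<open>x\<close> has to come from the base group.\<close>

lemma finite_subset_convex_span:
  assumes "finite F" "F \<subseteq> N" "subgroup N G"
  shows "\<exists>x\<in>N. \<one> \<sqsubseteq> x \<and> F \<subseteq> convex_span x"
  using assms(1,2)
proof (induction F)
  case empty
  then show ?case using subgroup.one_closed[OF assms(3)] le_refl by blast
next
  case (insert y F)
  then obtain x where x: "x \<in> N" "\<one> \<sqsubseteq> x" "F \<subseteq> convex_span x" by auto
  have yN: "y \<in> N" and yc: "y \<in> carrier G" and xc: "x \<in> carrier G"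
    using insert x subgroup.mem_carrier[OF assms(3)] by auto
  \<comment> \<open>The absolute value of \<open>y\<close>: whichever of \<open>y\<close> and its
    inverse lies above the identity.\<close>
  define z where "z = (if \<one> \<sqsubseteq> y then y else inv y)"
  have z: "z \<in> N" "\<one> \<sqsubseteq> z"
    using yN yc le_total[of \<one> y] inv_antimono[of y \<one>] subgroup.m_inv_closed[OF assms(3)]
    by (auto simp: z_def)
  have zc: "z \<in> carrier G" using z le_carrier by blast
  have yz: "y \<in> convex_span z"
    using subgroup.m_inv_closed[OF subgroup_convex_span[OF zc] convex_span_self[OF zc]] convex_span_self[OF zc] yc
    by (auto simp: z_def split: if_splits)
  show ?case
  proof (cases "x \<sqsubseteq> z")
    case True
    then have "x \<in> convex_span z"
      using convex_span_convex[OF subgroup.one_closed[OF subgroup_convex_span] convex_span_self] zc x by blast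
    then show ?thesis using convex_span_mono[OF zc] x z yz by blast
  next
    case False
    then have "z \<sqsubseteq> x" using le_total xc zc by blast
    then have "z \<in> convex_span x"
      using convex_span_convex[OF subgroup.one_closed[OF subgroup_convex_span] convex_span_self] xc z by blast
    then show ?thesis using convex_span_mono[OF xc] x yz by blast
  qed
qed

lemma convex_span_one: "convex_span \<one> = {\<one>}"
  by (auto simp: convex_span_def intro: le_antisym le_refl)

section \<open>The Hoelder coordinate on a convex span\<close>

text \<open>The coordinate that the Hoelder embedding of the Archimedean quotient assigns to \<^term>\<open>y\<close>, normalised
  to be \<open>1\<close> at \<^term>\<open>x\<close>; meaningful only for \<^term>\<open>x\<close> strictly above the identity and \<^term>\<open>y\<close> in the convex span.\<close>

definition ratio :: "'a \<Rightarrow> 'a \<Rightarrow> real" where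
  "ratio x y = Sup {real_of_int m / real n | m n. n > 0 \<and> x [^] m \<sqsubseteq> y [^] n}"

text \<open>The integer part of \<open>y\<close> measured in units of \<open>x\<close>. The
  exponents \<open>m\<close> with \<open>x [^] m\<close> below \<open>y\<close> are bounded because
  powers of \<open>x\<close> increase strictly, so there is a largest one.\<close>

lemma convex_span_floor:
  assumes "\<one> \<sqsubseteq> x" "x \<noteq> \<one>" "y \<in> convex_span x"
  shows "\<exists>m::int. x [^] m \<sqsubseteq> y \<and> y \<sqsubseteq> x [^] (m + 1)"
proof -
  obtain a b :: int where ab: "x [^] a \<sqsubseteq> y" "y \<sqsubseteq> x [^] b" using assms by (auto simp: convex_span_def)
  have c: "x \<in> carrier G" "y \<in> carrier G" using assms ab le_carrier by auto
  define S where "S = {m\<in>{a..b}. x [^] m \<sqsubseteq> y}"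
  have upper: "m \<le> b" if "x [^] m \<sqsubseteq> y" for m
    using that ab int_pow_le_imp_le[OF assms(1,2)] le_trans by blast
  have "finite S" unfolding S_def by (rule finite_subset[of _ "{a..b}"]) auto
  moreover have "a \<in> S" using ab upper by (auto simp: S_def)
  ultimately have m: "Max S \<in> S" "a \<le> Max S" "\<And>k. k \<in> S \<Longrightarrow> k \<le> Max S" by (auto intro: Max_in)
  have "\<not> x [^] (Max S + 1) \<sqsubseteq> y"
    using m upper[of "Max S + 1"] m(3)[of "Max S + 1"] by (auto simp: S_def)
  then have "y \<sqsubseteq> x [^] (Max S + 1)" using le_total c int_pow_closed by blast
  with m show ?thesis by (auto simp: S_def)
qed

lemma convex_span_floor_pow:
  assumes "\<one> \<sqsubseteq> x" "x \<noteq> \<one>" "y \<in> convex_span x"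
  shows "\<exists>m::int. x [^] m \<sqsubseteq> y [^] (n::nat) \<and> y [^] n \<sqsubseteq> x [^] (m + 1)"
proof (rule convex_span_floor[OF assms(1,2)])
  show "y [^] n \<in> convex_span x"
    using subgroup_int_pow_closed[OF subgroup_convex_span, of x y "int n"] assms le_carrier
    by (simp add: int_pow_int)
qed

text \<open>Raising the two hypotheses to the powers \<open>n'\<close> and \<open>n\<close> gives
  both the middle term \<open>y [^] (n * n')\<close>. The conclusion is
  \<open>m / n \<le> m' / n'\<close> in cross-multiplied form.\<close>

lemma pow_cross:
  assumes "\<one> \<sqsubseteq> x" "x \<noteq> \<one>" "y \<in> carrier G"
    and "x [^] (m::int) \<sqsubseteq> y [^] (n::nat)" "y [^] (n'::nat) \<sqsubseteq> x [^] (m'::int)"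
  shows "m * int n' \<le> m' * int n"
proof (rule int_pow_le_imp_le[OF assms(1,2)])
  have c: "x \<in> carrier G" using assms le_carrier by auto
  have "(x [^] m) [^] n' \<sqsubseteq> (y [^] n) [^] n'" by (intro nat_pow_mono assms)
  also have "(y [^] n) [^] n' = (y [^] n') [^] n"
    using assms by (simp add: nat_pow_pow mult.commute)
  finally have "(x [^] m) [^] n' \<sqsubseteq> (x [^] m') [^] n"
    using nat_pow_mono[OF assms(5)] le_trans by blast
  then have "(x [^] m) [^] int n' \<sqsubseteq> (x [^] m') [^] int n" by (simp only: int_pow_int)
  then show "x [^] (m * int n') \<sqsubseteq> x [^] (m' * int n)"
    using c by (simp only: int_pow_pow)
qed

text \<open>By \<open>pow_cross\<close> every fraction from below is at most every fraction from
  above, so the supremum separates the two kinds. For \<open>n = 0\<close> the claims only concern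
  the sign of \<open>m\<close>, which is settled by comparing \<open>x [^] m\<close> with the
  identity.\<close>

lemma
  assumes "\<one> \<sqsubseteq> x" "x \<noteq> \<one>" "y \<in> convex_span x"
  shows ratio_lower: "x [^] (m::int) \<sqsubseteq> y [^] (n::nat) \<Longrightarrow> real_of_int m \<le> real n * ratio x y"
    and ratio_upper: "y [^] (n::nat) \<sqsubseteq> x [^] (m::int) \<Longrightarrow> real n * ratio x y \<le> real_of_int m"
proof -
  have c: "x \<in> carrier G" "y \<in> carrier G" using assms le_carrier by (auto simp: convex_span_def)
  let ?S = "{real_of_int m / real n | m n. n > 0 \<and> x [^] m \<sqsubseteq> y [^] n}"
  obtain a b :: int where ab: "x [^] a \<sqsubseteq> y" "y \<sqsubseteq> x [^] b" using assms by (auto simp: convex_span_def)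
  have up: "s \<le> real_of_int m / real n" if s: "s \<in> ?S" and "y [^] n \<sqsubseteq> x [^] m" "n > 0" for s m n
  proof -
    obtain m' :: int and n' :: nat where s': "s = real_of_int m' / real n'" and "n' > 0" "x [^] m' \<sqsubseteq> y [^] n'"
      using s by blast
    moreover have "m' * int n \<le> m * int n'"
      using pow_cross assms c that calculation by blast
    then have "real_of_int m' * real n \<le> real_of_int m * real n'"
      by (metis of_int_le_iff of_int_mult of_int_of_nat_eq)
    ultimately show ?thesis unfolding s' using that(3) by (simp add: field_simps)
  qed
  \<comment> \<open>With denominator one, \<open>a\<close> makes the set of fractions nonempty and
    \<open>b\<close> bounds it from above.\<close>
  have "y [^] (1::nat) \<sqsubseteq> x [^] b" "x [^] a \<sqsubseteq> y [^] (1::nat)" using ab c by auto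
  then have ne: "?S \<noteq> {}" and bd: "bdd_above ?S"
    using up[of _ 1 b] by (blast intro: zero_less_one, intro bdd_aboveI[of _ "real_of_int b / real 1"]) auto
  have zero: "(m::int) \<le> 0" if "x [^] m \<sqsubseteq> y [^] (0::nat)" for m
    using int_pow_le_imp_le[OF assms(1,2), of m 0] that by simp
  have zero': "0 \<le> (m::int)" if "y [^] (0::nat) \<sqsubseteq> x [^] m" for m
    using int_pow_le_imp_le[OF assms(1,2), of 0 m] that by simp
  show "real_of_int m \<le> real n * ratio x y" if h: "x [^] m \<sqsubseteq> y [^] n" for m n
  proof (cases "n = 0")
    case True then show ?thesis using zero h by simp
  next
    case False
    then have "real_of_int m / real n \<in> ?S" using h by auto
    then have "real_of_int m / real n \<le> ratio x y"
      unfolding ratio_def using bd by (rule cSup_upper)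
    then show ?thesis using False by (simp add: field_simps)
  qed
  show "real n * ratio x y \<le> real_of_int m" if h: "y [^] n \<sqsubseteq> x [^] m" for m n
  proof (cases "n = 0")
    case True then show ?thesis using zero' h by simp
  next
    case False
    then have "ratio x y \<le> real_of_int m / real n"
      unfolding ratio_def using ne up h by (intro cSup_least) auto
    then show ?thesis using False by (simp add: field_simps)
  qed
qed

text \<open>This replaces commutativity in the proof that \<^term>\<open>ratio x\<close> is additive.\<close>

lemma pow_sandwich:
  assumes "y \<in> carrier G" "z \<in> carrier G" "y \<otimes> z \<sqsubseteq> w" "w \<sqsubseteq> z \<otimes> y"
  shows "y [^] n \<otimes> z [^] n \<sqsubseteq> w [^] n" "w [^] n \<sqsubseteq> z [^] n \<otimes> y [^] (n::nat)"
proof -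
  have yz: "y \<otimes> z \<sqsubseteq> z \<otimes> y" using assms le_trans by blast
  \<comment> \<open>A single factor is moved past a power one swap at a time, and each swap of
    \<open>y \<otimes> z\<close> into \<open>z \<otimes> y\<close> can only increase the product.
    The two bounds on \<open>w [^] n\<close> then follow by sorting the factors.\<close>
  have push: "y [^] n \<otimes> z \<sqsubseteq> z \<otimes> y [^] n" for n :: nat
  proof (induction n)
    case (Suc n)
    have "y [^] Suc n \<otimes> z = y [^] n \<otimes> (y \<otimes> z)" using assms by (simp add: m_assoc)
    also have "y [^] n \<otimes> (y \<otimes> z) \<sqsubseteq> y [^] n \<otimes> (z \<otimes> y)"
      using assms by (intro mult_mono yz le_refl) auto
    also have "y [^] n \<otimes> (z \<otimes> y) = y [^] n \<otimes> z \<otimes> y" using assms by (simp add: m_assoc)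
    also have "y [^] n \<otimes> z \<otimes> y \<sqsubseteq> z \<otimes> y [^] n \<otimes> y"
      using assms by (intro mult_mono Suc le_refl) auto
    finally (le_trans) show ?case using assms by (simp add: m_assoc)
  qed (use assms le_refl in auto)
  have push': "y \<otimes> z [^] n \<sqsubseteq> z [^] n \<otimes> y" for n :: nat
  proof (induction n)
    case (Suc n)
    have "y \<otimes> z [^] Suc n = y \<otimes> z [^] n \<otimes> z" using assms by (simp add: m_assoc)
    also have "y \<otimes> z [^] n \<otimes> z \<sqsubseteq> z [^] n \<otimes> y \<otimes> z"
      using assms by (intro mult_mono Suc le_refl) auto
    also have "z [^] n \<otimes> y \<otimes> z = z [^] n \<otimes> (y \<otimes> z)" using assms by (simp add: m_assoc)
    also have "z [^] n \<otimes> (y \<otimes> z) \<sqsubseteq> z [^] n \<otimes> (z \<otimes> y)"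
      using assms by (intro mult_mono yz le_refl) auto
    finally (le_trans) show ?case using assms by (simp add: m_assoc)
  qed (use assms le_refl in auto)
  show "y [^] n \<otimes> z [^] n \<sqsubseteq> w [^] n"
  proof (induction n)
    case (Suc n)
    have "y [^] Suc n \<otimes> z [^] Suc n = y [^] n \<otimes> (y \<otimes> z [^] n) \<otimes> z"
      using assms by (simp add: m_assoc)
    also have "y [^] n \<otimes> (y \<otimes> z [^] n) \<otimes> z \<sqsubseteq> y [^] n \<otimes> (z [^] n \<otimes> y) \<otimes> z"
      using assms by (intro mult_mono push' le_refl) auto
    also have "y [^] n \<otimes> (z [^] n \<otimes> y) \<otimes> z = (y [^] n \<otimes> z [^] n) \<otimes> (y \<otimes> z)"
      using assms by (simp add: m_assoc)
    also have "(y [^] n \<otimes> z [^] n) \<otimes> (y \<otimes> z) \<sqsubseteq> w [^] n \<otimes> w"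
      by (intro mult_mono Suc assms)
    finally (le_trans) show ?case by simp
  qed (use le_refl in auto)
  show "w [^] n \<sqsubseteq> z [^] n \<otimes> y [^] n"
  proof (induction n)
    case (Suc n)
    have "w [^] Suc n = w [^] n \<otimes> w" by simp
    also have "w [^] n \<otimes> w \<sqsubseteq> (z [^] n \<otimes> y [^] n) \<otimes> (z \<otimes> y)"
      by (intro mult_mono Suc assms)
    also have "(z [^] n \<otimes> y [^] n) \<otimes> (z \<otimes> y) = z [^] n \<otimes> (y [^] n \<otimes> z) \<otimes> y"
      using assms by (simp add: m_assoc)
    also have "z [^] n \<otimes> (y [^] n \<otimes> z) \<otimes> y \<sqsubseteq> z [^] n \<otimes> (z \<otimes> y [^] n) \<otimes> y"
      using assms by (intro mult_mono push le_refl) auto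
    finally (le_trans) show ?case using assms by (simp add: m_assoc)
  qed (use le_refl in auto)
qed

text \<open>If \<open>a\<close> and \<open>b\<close> are the integer parts of \<open>y [^] n\<close>
  and \<open>z [^] n\<close>, then \<open>n\<close> times either side lies between
  \<open>a + b\<close> and \<open>a + b + 2\<close>. The error stays bounded as \<open>n\<close>
  grows, so the two sides agree.\<close>

lemma ratio_mult:
  assumes x: "\<one> \<sqsubseteq> x" "x \<noteq> \<one>" and yz: "y \<in> convex_span x" "z \<in> convex_span x"
  shows "ratio x (y \<otimes> z) = ratio x y + ratio x z"
proof (rule eq_if_nat_multiples_close[of _ _ 2])
  fix n :: nat
  have c: "x \<in> carrier G" "y \<in> carrier G" "z \<in> carrier G"
    using assms le_carrier by (auto simp: convex_span_def)
  have m: "y \<otimes> z \<in> convex_span x" using subgroup.m_closed[OF subgroup_convex_span[OF c(1)] yz] .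
  obtain a b :: int where ab: "x [^] a \<sqsubseteq> y [^] n" "y [^] n \<sqsubseteq> x [^] (a + 1)"
    "x [^] b \<sqsubseteq> z [^] n" "z [^] n \<sqsubseteq> x [^] (b + 1)"
    using convex_span_floor_pow x yz by meson
  have s: "a + b + 2 = (a + 1) + (b + 1)" by simp
  have low: "x [^] (a + b) \<sqsubseteq> y [^] n \<otimes> z [^] n" "x [^] (a + b) \<sqsubseteq> z [^] n \<otimes> y [^] n"
    using mult_mono[OF ab(1,3)] mult_mono[OF ab(3,1)] c
    by (simp_all only: int_pow_mult[symmetric] add.commute[of b a])
  have high: "y [^] n \<otimes> z [^] n \<sqsubseteq> x [^] (a + b + 2)" "z [^] n \<otimes> y [^] n \<sqsubseteq> x [^] (a + b + 2)"
    using mult_mono[OF ab(2,4)] mult_mono[OF ab(4,2)] c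
    unfolding s by (simp_all only: int_pow_mult[symmetric] add.commute[of "b + 1" "a + 1"])
  have *: "x [^] (a + b) \<sqsubseteq> (y \<otimes> z) [^] n \<and> (y \<otimes> z) [^] n \<sqsubseteq> x [^] (a + b + 2)"
  \<comment> \<open>The element \<open>y \<otimes> z\<close> takes the place of \<open>w\<close> in
    \<open>pow_sandwich\<close>: as the lower end in the first case, as the upper end in the second,
    where \<open>y\<close> and \<open>z\<close> trade places.\<close>
  proof (cases "y \<otimes> z \<sqsubseteq> z \<otimes> y")
    case True
    then show ?thesis using pow_sandwich[OF c(2,3) le_refl True] c low high by (blast intro: le_trans)
  next
    case False
    then have le: "z \<otimes> y \<sqsubseteq> y \<otimes> z" using le_total c by blast
    show ?thesis using pow_sandwich[OF c(3,2) le le_refl] c low high by (blast intro: le_trans)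
  qed
  have "real_of_int (a + b) \<le> real n * ratio x (y \<otimes> z)" "real n * ratio x (y \<otimes> z) \<le> real_of_int (a + b + 2)"
    using ratio_lower[OF x m] ratio_upper[OF x m] * by blast+
  moreover have "real_of_int a \<le> real n * ratio x y" "real n * ratio x y \<le> real_of_int (a + 1)"
    using ratio_lower[OF x yz(1)] ratio_upper[OF x yz(1)] ab by blast+
  moreover have "real_of_int b \<le> real n * ratio x z" "real n * ratio x z \<le> real_of_int (b + 1)"
    using ratio_lower[OF x yz(2)] ratio_upper[OF x yz(2)] ab by blast+
  ultimately show "\<bar>real n * ratio x (y \<otimes> z) - real n * (ratio x y + ratio x z)\<bar> \<le> 2"
    by (simp add: distrib_left)
qed

text \<open>A gap in the wrong direction grows beyond one for some \<open>n\<close>, but the integer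
  part of \<open>y [^] n\<close> is also a lower bound for \<open>z [^] n\<close>.\<close>

lemma ratio_mono:
  assumes x: "\<one> \<sqsubseteq> x" "x \<noteq> \<one>" and yz: "y \<in> convex_span x" "z \<in> convex_span x" and "y \<sqsubseteq> z"
  shows "ratio x y \<le> ratio x z"
proof (rule ccontr)
  assume "\<not> ratio x y \<le> ratio x z"
  then obtain n :: nat where n: "1 < real n * (ratio x y - ratio x z)"
    using reals_Archimedean3[of "ratio x y - ratio x z"] by auto
  obtain a :: int where a: "x [^] a \<sqsubseteq> y [^] n" "y [^] n \<sqsubseteq> x [^] (a + 1)"
    using convex_span_floor_pow x yz by meson
  then have "x [^] a \<sqsubseteq> z [^] n" using nat_pow_mono[OF \<open>y \<sqsubseteq> z\<close>] le_trans by blast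
  then have "real_of_int a \<le> real n * ratio x z" using ratio_lower x yz by blast
  moreover have "real n * ratio x y \<le> real_of_int (a + 1)" using ratio_upper x yz a by blast
  ultimately show False using n by (simp add: algebra_simps)
qed

lemma ratio_self:
  assumes "\<one> \<sqsubseteq> x" "x \<noteq> \<one>"
  shows "ratio x x = 1"
proof -
  have c: "x \<in> carrier G" using assms le_carrier by auto
  then have "x [^] (1::int) \<sqsubseteq> x [^] (1::nat)" "x [^] (1::nat) \<sqsubseteq> x [^] (1::int)"
    by (auto intro: le_refl)
  then have "real_of_int 1 \<le> real 1 * ratio x x" "real 1 * ratio x x \<le> real_of_int 1"
    using ratio_lower ratio_upper assms convex_span_self[OF c] by blast+
  then show ?thesis by simp
qed

text \<open>Some \<open>n\<close> makes \<open>n * ratio x y\<close> larger than one in absolute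
  value, so \<open>y [^] n\<close> cannot lie between the inverse of \<open>x\<close> and
  \<open>x\<close>. It thus passes one of them, and convexity captures \<open>x\<close>.\<close>

lemma in_convex_span_if_ratio_nonzero:
  assumes x: "\<one> \<sqsubseteq> x" "x \<noteq> \<one>" and y: "y \<in> convex_span x" "ratio x y \<noteq> 0"
  shows "x \<in> convex_span y"
proof -
  have c: "x \<in> carrier G" "y \<in> carrier G" using assms le_carrier by (auto simp: convex_span_def)
  obtain n :: nat where n: "1 < real n * \<bar>ratio x y\<bar>"
    using reals_Archimedean3[of "\<bar>ratio x y\<bar>"] y by auto
  have n': "y [^] n \<in> convex_span y"
    using subgroup_int_pow_closed[OF subgroup_convex_span convex_span_self, of y "int n"] c by (simp add: int_pow_int)
  have "x \<sqsubseteq> y [^] n \<or> y [^] n \<sqsubseteq> inv x"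
  proof (rule ccontr)
    assume "\<not> ?thesis"
    then have "y [^] n \<sqsubseteq> x [^] (1::int)" "x [^] (-1::int) \<sqsubseteq> y [^] n"
      using le_total[of x "y [^] n"] le_total[of "inv x" "y [^] n"] c by (auto simp: int_pow_neg)
    then have "real n * ratio x y \<le> real_of_int 1" "real_of_int (-1) \<le> real n * ratio x y"
      using ratio_lower ratio_upper x y by blast+
    then show False using n by (simp add: abs_if split: if_splits)
  qed
  then show ?thesis
  proof
    assume "x \<sqsubseteq> y [^] n"
    then show ?thesis
      using convex_span_convex[OF subgroup.one_closed[OF subgroup_convex_span] n'] c x by blast
  next
    assume "y [^] n \<sqsubseteq> inv x"
    moreover have "inv x \<sqsubseteq> \<one>" using inv_antimono[OF x(1)] by simp
    ultimately have "inv x \<in> convex_span y"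
      using convex_span_convex[OF n' subgroup.one_closed[OF subgroup_convex_span]] c by blast
    then show ?thesis using subgroup.m_inv_closed[OF subgroup_convex_span] c by fastforce
  qed
qed

section \<open>Uniqueness of monotone homomorphisms and the effect of conjugation\<close>

text \<open>Bracketing \<open>y [^] n\<close> between consecutive powers \<open>a\<close> and
  \<open>a + 1\<close> of \<open>x\<close> and applying \<open>\<sigma>\<close> puts
  \<open>n * \<sigma> y\<close> between \<open>a * \<sigma> x\<close> and
  \<open>(a + 1) * \<sigma> x\<close>. The other side obeys the same bounds, so the error is at most
  \<open>\<sigma> x\<close> for every \<open>n\<close>.\<close>

lemma monotone_hom_eq_ratio:
  fixes \<sigma> :: "'a \<Rightarrow> real"
  assumes x: "\<one> \<sqsubseteq> x" "x \<noteq> \<one>"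
    and N: "subgroup N G" "x \<in> N" "N \<subseteq> convex_span x"
    and hom: "\<And>y z. y \<in> N \<Longrightarrow> z \<in> N \<Longrightarrow> \<sigma> (y \<otimes> z) = \<sigma> y + \<sigma> z"
    and mono: "\<And>y z. y \<in> N \<Longrightarrow> z \<in> N \<Longrightarrow> y \<sqsubseteq> z \<Longrightarrow> \<sigma> y \<le> \<sigma> z"
    and y: "y \<in> N"
  shows "\<sigma> y = \<sigma> x * ratio x y"
proof (rule eq_if_nat_multiples_close[of _ _ "\<sigma> x"])
  fix n :: nat
  have c: "x \<in> carrier G" and yc: "y \<in> convex_span x" using N y subgroup.mem_carrier by auto
  have pow: "z [^] k \<in> N" if "z \<in> N" for z and k :: nat
    using subgroup_int_pow_closed[OF N(1) that, of "int k"] by (simp add: int_pow_int)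
  have one: "\<sigma> \<one> = 0" using hom[of \<one> \<one>] subgroup.one_closed[OF N(1)] by simp
  have nat: "\<sigma> (z [^] k) = real k * \<sigma> z" if "z \<in> N" for z and k :: nat
    using that by (induction k) (simp_all add: one hom pow algebra_simps)
  have int: "\<sigma> (x [^] k) = real_of_int k * \<sigma> x" for k :: int
  proof (cases k rule: int_cases2)
    case (nonneg n)
    then show ?thesis using nat[OF N(2)] by (simp add: int_pow_int)
  next
    case (nonpos n)
    have "\<sigma> (inv (x [^] n)) + \<sigma> (x [^] n) = 0"
      using hom[of "inv (x [^] n)" "x [^] n"] pow[OF N(2)] subgroup.m_inv_closed[OF N(1)] one c
      by simp
    then show ?thesis using nat[OF N(2)] nonpos c by (simp add: int_pow_neg_int)
  qed
  obtain a :: int where a: "x [^] a \<sqsubseteq> y [^] n" "y [^] n \<sqsubseteq> x [^] (a + 1)"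
    using convex_span_floor_pow x yc by meson
  have ip: "x [^] k \<in> N" for k :: int by (rule subgroup_int_pow_closed[OF N(1,2)])
  have "real_of_int a * \<sigma> x \<le> real n * \<sigma> y" "real n * \<sigma> y \<le> real_of_int (a + 1) * \<sigma> x"
    using mono[OF ip pow[OF y] a(1)] mono[OF pow[OF y] ip a(2)] by (simp_all only: int nat[OF y])
  moreover have "0 \<le> \<sigma> x"
    using mono[OF subgroup.one_closed[OF N(1)] N(2) x(1)] one by simp
  moreover have "real_of_int a \<le> real n * ratio x y" "real n * ratio x y \<le> real_of_int (a + 1)"
    using ratio_lower[OF x yc] ratio_upper[OF x yc] a by blast+
  then have "\<sigma> x * real_of_int a \<le> \<sigma> x * (real n * ratio x y)"
    "\<sigma> x * (real n * ratio x y) \<le> \<sigma> x * real_of_int (a + 1)"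
    using \<open>0 \<le> \<sigma> x\<close> by (auto intro: mult_left_mono)
  ultimately show "\<bar>real n * \<sigma> y - real n * (\<sigma> x * ratio x y)\<bar> \<le> \<sigma> x"
    by (simp add: algebra_simps abs_le_iff)
qed

text \<open>Conjugation preserves the order and the normal subgroup \<open>N\<close>, so following
  it by \<open>ratio x\<close> gives another monotone homomorphism on \<open>N\<close>. By
  uniqueness it is a multiple of \<open>ratio x\<close>, and the factor is its value at
  \<open>x\<close>.\<close>

lemma ratio_conj:
  assumes x: "\<one> \<sqsubseteq> x" "x \<noteq> \<one>"
    and N: "N \<lhd> G" "x \<in> N" "N \<subseteq> convex_span x" and s: "s \<in> carrier G" and y: "y \<in> N"
  shows "ratio x (inv s \<otimes> y \<otimes> s) = ratio x (inv s \<otimes> x \<otimes> s) * ratio x y"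
proof (rule monotone_hom_eq_ratio[where \<sigma> = "\<lambda>y. ratio x (inv s \<otimes> y \<otimes> s)", OF x _ N(2,3) _ _ y])
  show sub: "subgroup N G" using N(1) by (rule normal_imp_subgroup)
  have conj: "inv s \<otimes> z \<otimes> s \<in> N" if "z \<in> N" for z
    using normal.inv_op_closed1[OF N(1) s that] .
  fix z w assume zw: "z \<in> N" "w \<in> N"
  have c: "z \<in> carrier G" "w \<in> carrier G" using subgroup.mem_carrier[OF sub] zw by auto
  have cancel: "s \<otimes> (inv s \<otimes> v) = v" if "v \<in> carrier G" for v
    using s that by (simp add: m_assoc[symmetric])
  have "inv s \<otimes> (z \<otimes> w) \<otimes> s = (inv s \<otimes> z \<otimes> s) \<otimes> (inv s \<otimes> w \<otimes> s)"
    using c s by (simp add: m_assoc cancel)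
  then show "ratio x (inv s \<otimes> (z \<otimes> w) \<otimes> s) = ratio x (inv s \<otimes> z \<otimes> s) + ratio x (inv s \<otimes> w \<otimes> s)"
    using ratio_mult[OF x] conj N(3) zw by auto
  show "ratio x (inv s \<otimes> z \<otimes> s) \<le> ratio x (inv s \<otimes> w \<otimes> s)" if "z \<sqsubseteq> w"
    using conj_mono[OF that s] conj N(3) zw by (intro ratio_mono x) auto
qed

text \<open>The scaling factor \<open>c g\<close> of conjugation by \<open>g\<close> is
  multiplicative in \<open>g\<close>, hence \<open>c (s [^] k)\<close> is a power of
  \<open>c s\<close>. It is nonnegative by monotonicity and nonzero because \<open>c (inv g)\<close>
  inverts it.\<close>

lemma ratio_conj_int_pow:
  assumes x: "\<one> \<sqsubseteq> x" "x \<noteq> \<one>"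
    and N: "N \<lhd> G" "x \<in> N" "N \<subseteq> convex_span x" and s: "s \<in> carrier G"
  shows "\<exists>r>0. \<forall>y\<in>N. \<forall>k::int. ratio x (inv (s [^] k) \<otimes> y \<otimes> (s [^] k)) = r powi k * ratio x y"
proof -
  define c where "c g = ratio x (inv g \<otimes> x \<otimes> g)" for g
  have sub: "subgroup N G" using N(1) by (rule normal_imp_subgroup)
  have xc: "x \<in> carrier G" using x le_carrier by auto
  have c: "ratio x (inv g \<otimes> y \<otimes> g) = c g * ratio x y" if "g \<in> carrier G" "y \<in> N" for g y
    unfolding c_def by (rule ratio_conj[OF x N that])
  have conjN: "inv g \<otimes> x \<otimes> g \<in> N" if "g \<in> carrier G" for g
    using normal.inv_op_closed1[OF N(1) that N(2)] .
  have c_mult: "c (g \<otimes> g') = c g' * c g" if "g \<in> carrier G" "g' \<in> carrier G" for g g'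
  proof -
    have "c (g \<otimes> g') = ratio x (inv g' \<otimes> (inv g \<otimes> x \<otimes> g) \<otimes> g')"
      unfolding c_def using that xc by (simp add: inv_mult_group m_assoc)
    then show ?thesis using c[OF that(2) conjN[OF that(1)]] by (simp add: c_def)
  qed
  have c_one: "c \<one> = 1" using xc ratio_self[OF x] by (simp add: c_def)
  have c_inv: "c g * c (inv g) = 1" if "g \<in> carrier G" for g
    using c_mult[of "inv g" g] that c_one by simp
  have one_convex_span: "\<one> \<in> convex_span x" using subgroup.one_closed[OF subgroup_convex_span[OF xc]] .
  have "0 \<le> c g" if "g \<in> carrier G" for g
  proof -
    have "ratio x \<one> = 0" using ratio_mult[OF x one_convex_span one_convex_span] by simp
    moreover have "\<one> \<sqsubseteq> inv g \<otimes> x \<otimes> g" using conj_mono[OF x(1) that] that by simp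
    ultimately show ?thesis
      unfolding c_def using ratio_mono[OF x one_convex_span] conjN[OF that] N(3) by fastforce
  qed
  then have pos: "0 < c s" using c_inv[OF s] s by (metis less_eq_real_def mult_zero_left zero_neq_one)
  have nat: "c (s [^] k) = c s ^ k" for k :: nat
    by (induction k) (simp_all add: c_one c_mult s)
  have "c (s [^] k) = c s powi k" for k :: int
  proof (cases k rule: int_cases2)
    case (nonneg n)
    then show ?thesis using nat by (simp add: int_pow_int)
  next
    case (nonpos n)
    then show ?thesis
      using c_inv[of "s [^] n"] nat[of n] pos s
      by (simp add: int_pow_neg_int power_int_minus field_simps)
  qed
  then show ?thesis using pos c s by (intro exI[of _ "c s"]) auto
qed

end

section \<open>Chains and homology classes\<close>

lemma sum_keys_superset:
  fixes F :: "'a \<Rightarrow> 'b::zero \<Rightarrow> 'c::comm_monoid_add"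
  assumes "finite S" "Poly_Mapping.keys c \<subseteq> S" "\<And>x. F x 0 = 0"
  shows "(\<Sum>x\<in>Poly_Mapping.keys c. F x (Poly_Mapping.lookup c x)) = (\<Sum>x\<in>S. F x (Poly_Mapping.lookup c x))"
  using assms by (intro sum.mono_neutral_left) (auto simp: in_keys_iff)

text \<open>Cancellation can make the support of \<open>c + d\<close> smaller than the union of the
  two supports, so all three sums are first extended by zeros to that union.\<close>

lemma sum_keys_add:
  fixes F :: "'a \<Rightarrow> 'b::monoid_add \<Rightarrow> 'c::comm_monoid_add"
  assumes "\<And>x. F x 0 = 0" "\<And>x a b. F x (a + b) = F x a + F x b"
  shows "(\<Sum>x\<in>Poly_Mapping.keys (c + d). F x (Poly_Mapping.lookup (c + d) x)) =
    (\<Sum>x\<in>Poly_Mapping.keys c. F x (Poly_Mapping.lookup c x)) +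
    (\<Sum>x\<in>Poly_Mapping.keys d. F x (Poly_Mapping.lookup d x))"
proof -
  let ?S = "Poly_Mapping.keys c \<union> Poly_Mapping.keys d"
  note * = sum_keys_superset[where F = F and S = ?S, OF _ _ assms(1)]
  show ?thesis
    by (subst *[of c], simp, simp, subst *[of d], simp, simp, subst *[of "c + d"])
      (auto simp: keys_add assms(2) lookup_add sum.distrib)
qed

section \<open>Real functionals on rational chains\<close>

text \<open>The rational-linear extension of \<open>\<tau>\<close> to chains. If
  \<open>\<tau>\<close> is additive on the group, it descends to a functional on first
  homology.\<close>

definition pair_chain :: "('a \<Rightarrow> real) \<Rightarrow> ('a \<Rightarrow>\<^sub>0 rat) \<Rightarrow> real" where
  "pair_chain \<tau> c = (\<Sum>x\<in>Poly_Mapping.keys c. of_rat (Poly_Mapping.lookup c x) * \<tau> x)"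

lemma pair_chain_add: "pair_chain \<tau> (c + d) = pair_chain \<tau> c + pair_chain \<tau> d"
  unfolding pair_chain_def
  by (rule sum_keys_add[where F = "\<lambda>x q. of_rat q * \<tau> x"]) (auto simp: of_rat_add distrib_right)

lemma pair_chain_single: "pair_chain \<tau> (Poly_Mapping.single x q) = of_rat q * \<tau> x"
  by (simp add: pair_chain_def)

lemma pair_chain_zero: "pair_chain \<tau> 0 = 0"
  by (simp add: pair_chain_def)

lemma pair_chain_diff: "pair_chain \<tau> (c - d) = pair_chain \<tau> c - pair_chain \<tau> d"
  using pair_chain_add[of \<tau> "c - d" d] by simp

lemma pair_chain_sum: "pair_chain \<tau> (\<Sum>i\<in>I. c i) = (\<Sum>i\<in>I. pair_chain \<tau> (c i))"
  by (induction I rule: infinite_finite_induct) (auto simp: pair_chain_zero pair_chain_add)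

lemmas pair_chain_simps = pair_chain_add pair_chain_single pair_chain_zero pair_chain_diff pair_chain_sum

lemma pair_chain_chain_map: "pair_chain \<tau> (chain_map f c) = pair_chain (\<tau> \<circ> f) c"
  unfolding chain_map_def pair_chain_simps by (simp add: pair_chain_def)

text \<open>On the boundary of a generator \<open>(x, y)\<close> the functional takes the value
  \<open>\<tau> y - \<tau> (x \<otimes> y) + \<tau> x\<close>, which additivity makes zero.\<close>

lemma pair_chain_boundaries:
  assumes "\<And>x y. x \<in> carrier G \<Longrightarrow> y \<in> carrier G \<Longrightarrow> \<tau> (x \<otimes>\<^bsub>G\<^esub> y) = \<tau> x + \<tau> y"
    and "b \<in> boundaries G"
  shows "pair_chain \<tau> b = 0"
proof -
  obtain c where c: "b = bar_boundary G c" "Poly_Mapping.keys c \<subseteq> carrier G \<times> carrier G"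
    using assms(2) by (auto simp: boundaries_def)
  show ?thesis
    unfolding c(1) bar_boundary_def pair_chain_sum
    using c(2) assms(1) by (intro sum.neutral) (auto simp: pair_chain_simps algebra_simps)
qed

section \<open>The subgroup of boundaries\<close>

lemma bar_boundary_add: "bar_boundary G (c + d) = bar_boundary G c + bar_boundary G d"
proof -
  let ?F = "\<lambda>z q. Poly_Mapping.single (snd z) q
     - Poly_Mapping.single (fst z \<otimes>\<^bsub>G\<^esub> snd z) q + Poly_Mapping.single (fst z) q"
  show ?thesis
    using sum_keys_add[where F = ?F and c = c and d = d]
    by (simp add: single_add bar_boundary_def case_prod_unfold)
qed

lemma bar_boundary_single:
  "bar_boundary G (Poly_Mapping.single (x, y) q) =
    Poly_Mapping.single y q - Poly_Mapping.single (x \<otimes>\<^bsub>G\<^esub> y) q + Poly_Mapping.single x q"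
  by (simp add: bar_boundary_def)

lemma zero_in_boundaries: "0 \<in> boundaries G"
  unfolding boundaries_def by (rule image_eqI[of _ _ 0]) (auto simp: bar_boundary_def)

lemma add_in_boundaries:
  assumes "b \<in> boundaries G" "b' \<in> boundaries G"
  shows "b + b' \<in> boundaries G"
proof -
  obtain c d where "b = bar_boundary G c" "Poly_Mapping.keys c \<subseteq> carrier G \<times> carrier G"
    "b' = bar_boundary G d" "Poly_Mapping.keys d \<subseteq> carrier G \<times> carrier G"
    using assms by (auto simp: boundaries_def)
  then show ?thesis
    unfolding boundaries_def using keys_add[of c d]
    by (intro image_eqI[of _ _ "c + d"]) (auto simp: bar_boundary_add)
qed

lemma uminus_in_boundaries:
  assumes "b \<in> boundaries G"
  shows "- b \<in> boundaries G"
proof -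
  obtain c where c: "b = bar_boundary G c" "Poly_Mapping.keys c \<subseteq> carrier G \<times> carrier G"
    using assms by (auto simp: boundaries_def)
  have "bar_boundary G (- c) + b = 0"
    using bar_boundary_add[of G "- c" c] c by (simp add: bar_boundary_def)
  then have "- b = bar_boundary G (- c)" by (intro minus_unique) (simp add: add.commute)
  moreover have "Poly_Mapping.keys (- c) = Poly_Mapping.keys c" by (auto simp: in_keys_iff)
  ultimately show ?thesis using c by (auto simp: boundaries_def)
qed

lemma sum_in_boundaries:
  "(\<And>i. i \<in> I \<Longrightarrow> b i \<in> boundaries G) \<Longrightarrow> (\<Sum>i\<in>I. b i) \<in> boundaries G"
  by (induction I rule: infinite_finite_induct) (auto simp: zero_in_boundaries add_in_boundaries)

lemma single_in_boundaries:
  assumes "x \<in> carrier G" "y \<in> carrier G"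
  shows "Poly_Mapping.single y q - Poly_Mapping.single (x \<otimes>\<^bsub>G\<^esub> y) q + Poly_Mapping.single x q \<in> boundaries G"
  unfolding bar_boundary_single[symmetric] boundaries_def using assms by (intro imageI) auto

text \<open>Boundaries are finite sums of three-term chains, so only these have to be checked. With
  the coefficient \<open>q\<close> kept inside \<open>single\<close>, additivity of \<open>L\<close>
  suffices. It serves both induced chain maps and the Laurent action.\<close>

lemma additive_maps_boundaries:
  fixes L :: "('a \<Rightarrow>\<^sub>0 rat) \<Rightarrow> ('b \<Rightarrow>\<^sub>0 rat)"
  assumes add: "\<And>c d. L (c + d) = L c + L d"
    and single: "\<And>x y q. x \<in> carrier K \<Longrightarrow> y \<in> carrier K \<Longrightarrow>
      L (Poly_Mapping.single y q) - L (Poly_Mapping.single (x \<otimes>\<^bsub>K\<^esub> y) q) + L (Poly_Mapping.single x q)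
        \<in> boundaries M"
    and "b \<in> boundaries K"
  shows "L b \<in> boundaries M"
proof -
  have zero: "L 0 = 0" using add[of 0 0] by simp
  have diff: "L (c - d) = L c - L d" for c d using add[of "c - d" d] by simp
  have sum: "L (\<Sum>i\<in>I. c i) = (\<Sum>i\<in>I. L (c i))" for I and c :: "'a \<times> 'a \<Rightarrow> 'a \<Rightarrow>\<^sub>0 rat"
    by (induction I rule: infinite_finite_induct) (auto simp: zero add)
  obtain c where c: "b = bar_boundary K c" "Poly_Mapping.keys c \<subseteq> carrier K \<times> carrier K"
    using assms(3) by (auto simp: boundaries_def)
  show ?thesis
    unfolding c(1) bar_boundary_def sum
  proof (rule sum_in_boundaries)
    fix z assume "z \<in> Poly_Mapping.keys c"
    with c(2) obtain x y where z: "z = (x, y)" and xy: "x \<in> carrier K" "y \<in> carrier K" by auto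
    show "L (case z of (x, y) \<Rightarrow> Poly_Mapping.single y (Poly_Mapping.lookup c (x, y))
        - Poly_Mapping.single (x \<otimes>\<^bsub>K\<^esub> y) (Poly_Mapping.lookup c (x, y))
        + Poly_Mapping.single x (Poly_Mapping.lookup c (x, y))) \<in> boundaries M"
      unfolding z prod.case add diff by (intro single xy)
  qed
qed

section \<open>Homology classes and induced maps\<close>

lemma H1_class_eq: "H1_class G c = {b + c | b. b \<in> boundaries G}"
  by (auto simp: H1_class_def r_coset_def chain_group_def)

lemma carrier_H1_group:
  "carrier (H1_group G) = H1_class G ` {c. Poly_Mapping.keys c \<subseteq> carrier G}"
  by (auto simp: H1_group_def FactGroup_def RCOSETS_def H1_class_def chain_group_def)

lemma in_H1_class: "c \<in> H1_class G c"
  unfolding H1_class_eq by (intro CollectI exI[of _ 0]) (simp add: zero_in_boundaries)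

lemma H1_class_add_boundary:
  assumes b: "b \<in> boundaries G"
  shows "H1_class G (b + c) = H1_class G c"
proof
  show "H1_class G c \<subseteq> H1_class G (b + c)"
  proof
    fix x assume "x \<in> H1_class G c"
    then obtain b' where b': "b' \<in> boundaries G" "x = b' + c" by (auto simp: H1_class_eq)
    then have "x = (b' + - b) + (b + c)" by (simp add: add.assoc)
    moreover have "b' + - b \<in> boundaries G" by (intro add_in_boundaries uminus_in_boundaries b b'(1))
    ultimately show "x \<in> H1_class G (b + c)" unfolding H1_class_eq by blast
  qed
  show "H1_class G (b + c) \<subseteq> H1_class G c"
  proof
    fix x assume "x \<in> H1_class G (b + c)"
    then obtain b' where b': "b' \<in> boundaries G" "x = b' + (b + c)" by (auto simp: H1_class_eq)
    then have "x = (b' + b) + c" by (simp add: add.assoc)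
    moreover have "b' + b \<in> boundaries G" by (intro add_in_boundaries b b'(1))
    ultimately show "x \<in> H1_class G c" unfolding H1_class_eq by blast
  qed
qed

lemma pair_chain_H1_class:
  assumes "\<And>x y. x \<in> carrier G \<Longrightarrow> y \<in> carrier G \<Longrightarrow> \<tau> (x \<otimes>\<^bsub>G\<^esub> y) = \<tau> x + \<tau> y"
    and "H1_class G c = H1_class G d"
  shows "pair_chain \<tau> c = pair_chain \<tau> d"
proof -
  have "c \<in> H1_class G d" using in_H1_class[of c G] by (simp only: assms(2))
  then obtain b where b: "b \<in> boundaries G" "c = b + d" unfolding H1_class_eq by blast
  have "pair_chain \<tau> b = 0" by (rule pair_chain_boundaries[OF assms(1) b(1)])
  then show ?thesis unfolding b(2) pair_chain_add by simp
qed

text \<open>Representatives of a class differ by boundaries, which \<open>L\<close> preserves, so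
  the image is a singleton. This justifies the use of \<open>the_elem\<close> in
  \<open>H1_map\<close> and in the scalar multiplication of \<open>alexander_module\<close>.\<close>

lemma the_elem_H1_class_image:
  assumes "\<And>c d. L (c + d) = L c + L d" "\<And>b. b \<in> boundaries K \<Longrightarrow> L b \<in> boundaries M"
  shows "the_elem ((\<lambda>c. H1_class M (L c)) ` H1_class K c) = H1_class M (L c)"
proof -
  have "H1_class M (L d) = H1_class M (L c)" if d: "d \<in> H1_class K c" for d
  proof -
    obtain b where b: "b \<in> boundaries K" "d = b + c" using d unfolding H1_class_eq by blast
    show ?thesis unfolding b(2) assms(1) by (intro H1_class_add_boundary assms(2) b(1))
  qed
  then have "(\<lambda>c. H1_class M (L c)) ` H1_class K c = {H1_class M (L c)}"
    using in_H1_class[of c K] by blast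
  then show ?thesis by simp
qed

lemma chain_map_add: "chain_map f (c + d) = chain_map f c + chain_map f d"
  unfolding chain_map_def
  by (rule sum_keys_add[where F = "\<lambda>x. Poly_Mapping.single (f x)"]) (auto simp: single_add)

lemma H1_map_class:
  assumes "f \<in> hom K M"
  shows "H1_map M f (H1_class K c) = H1_class M (chain_map f c)"
  unfolding H1_map_def
proof (rule the_elem_H1_class_image[where L = "chain_map f"])
  show "chain_map f (c + d) = chain_map f c + chain_map f d" for c d by (rule chain_map_add)
  have single: "chain_map f (Poly_Mapping.single x q) = Poly_Mapping.single (f x) q" for x q
    by (simp add: chain_map_def)
  have bound: "Poly_Mapping.single (f y) q - Poly_Mapping.single (f (x \<otimes>\<^bsub>K\<^esub> y)) q
      + Poly_Mapping.single (f x) q \<in> boundaries M" if "x \<in> carrier K" "y \<in> carrier K" for x y q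
    unfolding hom_mult[OF assms that]
    by (intro single_in_boundaries hom_in_carrier[OF assms] that)
  show "chain_map f b \<in> boundaries M" if "b \<in> boundaries K" for b
    by (rule additive_maps_boundaries[where L = "chain_map f", OF chain_map_add _ that])
      (unfold single, rule bound)
qed

text \<open>By surjectivity the class of \<open>x\<close> is the image of the class of some chain on
  \<open>A\<close>. If \<open>\<tau>\<close> vanished on every \<open>f a\<close>, the induced
  functional would vanish on that image, contradicting its value \<open>\<tau> x\<close>.\<close>

lemma H1_surjective_detects:
  assumes "f \<in> hom A H" "H1_map H f ` carrier (H1_group A) = carrier (H1_group H)"
    and \<tau>: "\<And>x y. x \<in> carrier H \<Longrightarrow> y \<in> carrier H \<Longrightarrow> \<tau> (x \<otimes>\<^bsub>H\<^esub> y) = \<tau> x + (\<tau> y :: real)"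
    and x: "x \<in> carrier H" "\<tau> x \<noteq> 0"
  shows "\<exists>a\<in>carrier A. \<tau> (f a) \<noteq> 0"
proof (rule ccontr)
  assume contr: "\<not> ?thesis"
  have "H1_class H (Poly_Mapping.single x 1) \<in> carrier (H1_group H)"
    unfolding carrier_H1_group using x by (intro imageI CollectI) simp
  then obtain c where c: "Poly_Mapping.keys c \<subseteq> carrier A"
    "H1_class H (Poly_Mapping.single x 1) = H1_map H f (H1_class A c)"
    unfolding assms(2)[symmetric] unfolding carrier_H1_group by (elim imageE CollectE) simp
  have "pair_chain \<tau> (Poly_Mapping.single x 1) = pair_chain \<tau> (chain_map f c)"
    by (rule pair_chain_H1_class[where G = H]) (rule \<tau>, assumption+, rule c(2)[unfolded H1_map_class[OF assms(1)]])
  also have "\<dots> = 0"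
    unfolding pair_chain_chain_map unfolding pair_chain_def
  proof (rule sum.neutral, rule ballI)
    fix a assume "a \<in> Poly_Mapping.keys c"
    then show "of_rat (Poly_Mapping.lookup c a) * (\<tau> \<circ> f) a = 0" using contr c(1) by auto
  qed
  finally show False using x by (simp add: pair_chain_single)
qed

section \<open>The action of Laurent polynomials on chains, and cyclic modules\<close>

lemma laurent_act_add: "laurent_act G s p (c + d) = laurent_act G s p c + laurent_act G s p d"
  unfolding laurent_act_def sum.distrib[symmetric]
proof (rule sum.cong[OF refl])
  fix k
  let ?F = "\<lambda>x q. Poly_Mapping.single (inv\<^bsub>G\<^esub> (s [^]\<^bsub>G\<^esub> k) \<otimes>\<^bsub>G\<^esub> x \<otimes>\<^bsub>G\<^esub> (s [^]\<^bsub>G\<^esub> k)) (Poly_Mapping.lookup p k * q)"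
  show "(\<Sum>x\<in>Poly_Mapping.keys (c + d). ?F x (Poly_Mapping.lookup (c + d) x)) =
    (\<Sum>x\<in>Poly_Mapping.keys c. ?F x (Poly_Mapping.lookup c x)) +
    (\<Sum>x\<in>Poly_Mapping.keys d. ?F x (Poly_Mapping.lookup d x))"
    by (rule sum_keys_add[where F = ?F]) (auto simp: single_add distrib_left)
qed

lemma keys_laurent_act:
  assumes "\<And>x k. x \<in> K \<Longrightarrow> inv\<^bsub>G\<^esub> (s [^]\<^bsub>G\<^esub> (k::int)) \<otimes>\<^bsub>G\<^esub> x \<otimes>\<^bsub>G\<^esub> (s [^]\<^bsub>G\<^esub> k) \<in> K"
    and "Poly_Mapping.keys c \<subseteq> K"
  shows "Poly_Mapping.keys (laurent_act G s p c) \<subseteq> K"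
proof -
  have keys_sum: "Poly_Mapping.keys (\<Sum>i\<in>I. F i) \<subseteq> K"
    if "\<And>i. i \<in> I \<Longrightarrow> Poly_Mapping.keys (F i) \<subseteq> K" for I :: "'i set" and F :: "'i \<Rightarrow> 'a \<Rightarrow>\<^sub>0 rat"
    using that
  proof (induction I rule: infinite_finite_induct)
    case (insert i I)
    then show ?case using keys_add[of "F i" "\<Sum>i\<in>I. F i"] by auto
  qed auto
  show ?thesis
    unfolding laurent_act_def using assms by (intro keys_sum) (auto split: if_splits)
qed

text \<open>Each conjugate by \<open>s [^] k\<close> contributes a factor \<open>r powi k\<close>,
  so the double sum splits into a product.\<close>

lemma pair_chain_laurent_act:
  assumes "\<And>x k. x \<in> K \<Longrightarrow> \<tau> (inv\<^bsub>G\<^esub> (s [^]\<^bsub>G\<^esub> (k::int)) \<otimes>\<^bsub>G\<^esub> x \<otimes>\<^bsub>G\<^esub> (s [^]\<^bsub>G\<^esub> k)) = r powi k * \<tau> x"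
    and "Poly_Mapping.keys c \<subseteq> K"
  shows "pair_chain \<tau> (laurent_act G s p c) = laurent_eval p r * pair_chain \<tau> c"
proof -
  have "pair_chain \<tau> (laurent_act G s p c) = (\<Sum>k\<in>Poly_Mapping.keys p. \<Sum>x\<in>Poly_Mapping.keys c.
     (of_rat (Poly_Mapping.lookup p k) * r powi k) * (of_rat (Poly_Mapping.lookup c x) * \<tau> x))"
    unfolding laurent_act_def pair_chain_simps using assms
    by (intro sum.cong refl) (auto simp: of_rat_mult)
  then show ?thesis by (simp only: laurent_eval_def pair_chain_def sum_product)
qed

text \<open>A multiple of \<open>q\<close> sends every coset into the ideal. Expressing zero as
  \<open>0\<close> acting on \<open>v\<close> lets the equality be carried through a module
  isomorphism by its compatibility with scalars.\<close>

lemma laurent_cyclic_annihilated: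
  assumes "v \<in> carrier (laurent_cyclic q)" "q dvd r"
  shows "r \<odot>\<^bsub>laurent_cyclic q\<^esub> v = 0 \<odot>\<^bsub>laurent_cyclic q\<^esub> v"
proof -
  interpret R: cring "laurent_ring" by (rule cring_from_type_algebra)
  let ?I = "PIdl\<^bsub>laurent_ring\<^esub> q"
  have c: "carrier laurent_ring = UNIV" by (simp add: ring_of_type_algebra_def)
  interpret I: ideal ?I laurent_ring by (rule R.cgenideal_ideal) (simp add: c)
  obtain u where u: "v = ?I +>\<^bsub>laurent_ring\<^esub> u"
    using assms(1) by (auto simp: laurent_cyclic_def Let_def FactRing_def A_RCOSETS_defs a_r_coset_def)
  have mult: "r' \<odot>\<^bsub>laurent_cyclic q\<^esub> v = ?I +>\<^bsub>laurent_ring\<^esub> (r' * u)" for r'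
    unfolding u using I.rcoset_mult_add[of r' u]
    by (simp add: laurent_cyclic_def Let_def FactRing_def c) (simp add: ring_of_type_algebra_def)
  have "r * u \<in> ?I"
    using assms(2) by (auto simp: cgenideal_def c dvd_def) (auto simp: ring_of_type_algebra_def mult_ac)
  then have "?I +>\<^bsub>laurent_ring\<^esub> (r * u) = ?I" by (intro R.a_coset_join2 I.a_subgroup) (simp_all add: c)
  moreover have "0 * u \<in> ?I" using I.zero_closed by (simp add: ring_of_type_algebra_def)
  then have "?I +>\<^bsub>laurent_ring\<^esub> (0 * u) = ?I" by (intro R.a_coset_join2 I.a_subgroup) (simp_all add: c)
  ultimately show ?thesis unfolding mult by simp
qed

section \<open>HNN extensions and the Alexander module\<close>

text \<open>As \<open>N\<close> contains the base and is stable under conjugation by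
  \<open>t\<close> in both directions, every element has the form \<open>t [^] k\<close> times an
  element of \<open>N\<close>. Since \<open>\<phi>\<close> reads off \<open>k\<close>, elements of
  the kernel have \<open>k = 0\<close>.\<close>

lemma hnn_subgroup_contains_kernel:
  fixes A :: "('a, 'k) monoid_scheme" and H :: "('h, 'm) monoid_scheme" and ip im :: "'a \<Rightarrow> 'h"
  defines "G \<equiv> hnn_extension A H ip im" and "t \<equiv> hnn_stable A H ip im"
  assumes hnn: "group A" "group H" "ip \<in> hom A H" "im \<in> hom A H"
    and \<phi>: "\<phi> \<in> hom G integer_group" "\<phi> t = 1"
    and N: "subgroup N G" "N \<subseteq> kernel G integer_group \<phi>" "hnn_base A H ip im ` carrier H \<subseteq> N"
    and conj: "\<And>c. c \<in> N \<Longrightarrow> inv\<^bsub>G\<^esub> t \<otimes>\<^bsub>G\<^esub> c \<otimes>\<^bsub>G\<^esub> t \<in> N" "\<And>c. c \<in> N \<Longrightarrow> t \<otimes>\<^bsub>G\<^esub> c \<otimes>\<^bsub>G\<^esub> inv\<^bsub>G\<^esub> t \<in> N"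
  shows "kernel G integer_group \<phi> \<subseteq> N"
proof
  interpret G: group G unfolding G_def by (rule group_hnn_extension[OF hnn])
  interpret \<phi>: group_hom G integer_group \<phi>
    by (intro group_hom.intro group_hom_axioms.intro G.is_group group_integer_group \<phi>(1))
  have t: "t \<in> carrier G" unfolding G_def t_def by (rule hnn_stable_carrier[OF hnn])
  have cN: "c \<in> carrier G" if "c \<in> N" for c using N(1) that by (rule subgroup.mem_carrier)
  have decomp: "\<exists>(k::int) c. c \<in> N \<and> hnn_class A H ip im w = t [^]\<^bsub>G\<^esub> k \<otimes>\<^bsub>G\<^esub> c"
    if "w \<in> hnn_words H" for w
    using that
  proof (induction w rule: rev_induct)
    case Nil
    have "hnn_class A H ip im [] = \<one>\<^bsub>G\<^esub>" by (simp add: G_def hnn_extension_def)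
    then have "hnn_class A H ip im [] = t [^]\<^bsub>G\<^esub> (0::int) \<otimes>\<^bsub>G\<^esub> \<one>\<^bsub>G\<^esub>" by simp
    then show ?case using subgroup.one_closed[OF N(1)] by blast
  next
    case (snoc l w)
    then have w: "w \<in> hnn_words H" and l: "[l] \<in> hnn_words H" by (auto simp: hnn_words_def)
    obtain k :: int and c where c: "c \<in> N" "hnn_class A H ip im w = t [^]\<^bsub>G\<^esub> k \<otimes>\<^bsub>G\<^esub> c"
      using snoc w by blast
    have step: "hnn_class A H ip im (w @ [l]) = t [^]\<^bsub>G\<^esub> k \<otimes>\<^bsub>G\<^esub> c \<otimes>\<^bsub>G\<^esub> hnn_class A H ip im [l]"
      using hnn_mult_class[OF hnn w l] c(2) by (simp add: G_def)
    show ?case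
    proof (cases l)
      case (Base h)
      then have "hnn_class A H ip im [l] \<in> N"
        using N(3) l by (auto simp: hnn_base_def hnn_words_def)
      then show ?thesis
        using subgroup.m_closed[OF N(1) c(1)] step c(1) cN t
        by (auto simp: G.m_assoc intro!: exI[of _ k])
    next
      case Stable
      then have "hnn_class A H ip im [l] = t" by (simp add: t_def hnn_stable_def)
      \<comment> \<open>The new letter moves left past \<open>c\<close> at the price of conjugating
        \<open>c\<close>, so the exponent grows by one and the rest stays in
        \<open>N\<close>.\<close>
      moreover have "t [^]\<^bsub>G\<^esub> (k + 1) \<otimes>\<^bsub>G\<^esub> (inv\<^bsub>G\<^esub> t \<otimes>\<^bsub>G\<^esub> c \<otimes>\<^bsub>G\<^esub> t) = t [^]\<^bsub>G\<^esub> k \<otimes>\<^bsub>G\<^esub> (t \<otimes>\<^bsub>G\<^esub> inv\<^bsub>G\<^esub> t) \<otimes>\<^bsub>G\<^esub> c \<otimes>\<^bsub>G\<^esub> t"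
        using t cN[OF c(1)] by (simp only: G.int_pow_mult G.int_pow_1 G.m_assoc G.m_closed G.inv_closed G.int_pow_closed)
      ultimately show ?thesis
        using step conj(1)[OF c(1)] t cN[OF c(1)] by (metis G.int_pow_closed G.r_inv G.r_one)
    next
      case StableInv
      then have "hnn_class A H ip im [l] = inv\<^bsub>G\<^esub> t"
        unfolding t_def G_def by (simp add: hnn_inv_stable[OF hnn])
      moreover have "t [^]\<^bsub>G\<^esub> (k - 1) \<otimes>\<^bsub>G\<^esub> (t \<otimes>\<^bsub>G\<^esub> c \<otimes>\<^bsub>G\<^esub> inv\<^bsub>G\<^esub> t) = t [^]\<^bsub>G\<^esub> k \<otimes>\<^bsub>G\<^esub> (inv\<^bsub>G\<^esub> t \<otimes>\<^bsub>G\<^esub> t) \<otimes>\<^bsub>G\<^esub> c \<otimes>\<^bsub>G\<^esub> inv\<^bsub>G\<^esub> t"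
        using t cN[OF c(1)] by (simp only: G.int_pow_diff G.int_pow_1 G.m_assoc G.m_closed G.inv_closed G.int_pow_closed)
      ultimately show ?thesis
        using step conj(2)[OF c(1)] t cN[OF c(1)] by (metis G.int_pow_closed G.l_inv G.r_one)
    qed
  qed
  fix y assume y: "y \<in> kernel G integer_group \<phi>"
  then have "y \<in> carrier G" "\<phi> y = 0" by (auto simp: kernel_def)
  moreover have "\<exists>w\<in>hnn_words H. y = hnn_class A H ip im w"
    using \<open>y \<in> carrier G\<close> by (auto simp: G_def hnn_extension_def)
  ultimately obtain k :: int and c where c: "c \<in> N" "y = t [^]\<^bsub>G\<^esub> k \<otimes>\<^bsub>G\<^esub> c"
    using decomp by blast
  have "\<phi> c = 0" using c N(2) by (auto simp: kernel_def)
  then have "k = 0"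
    using \<open>\<phi> y = 0\<close> c t cN[OF c(1)] \<phi>(2) by (simp add: \<phi>.hom_int_pow)
  then show "y \<in> N" using c cN[OF c(1)] by simp
qed

section \<open>The Alexander module and the roots of its polynomial\<close>

text \<open>Conjugation by \<open>s [^] k\<close> is multiplicative on \<open>N\<close>, so it
  carries the boundary of \<open>(x, y)\<close> to the boundary of the pair of conjugates.\<close>

lemma laurent_act_boundaries:
  assumes "N \<lhd> G" "s \<in> carrier G" "b \<in> boundaries (G\<lparr>carrier := N\<rparr>)"
  shows "laurent_act G s p b \<in> boundaries (G\<lparr>carrier := N\<rparr>)"
proof (rule additive_maps_boundaries[where L = "laurent_act G s p", OF laurent_act_add _ assms(3)])
  interpret normal N G by (fact assms(1))
  let ?K = "G\<lparr>carrier := N\<rparr>"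
  define cj where "cj k x = inv\<^bsub>G\<^esub> (s [^]\<^bsub>G\<^esub> (k::int)) \<otimes>\<^bsub>G\<^esub> x \<otimes>\<^bsub>G\<^esub> (s [^]\<^bsub>G\<^esub> k)" for k x
  have act: "laurent_act G s p (Poly_Mapping.single x q) =
      (\<Sum>k\<in>Poly_Mapping.keys p. Poly_Mapping.single (cj k x) (Poly_Mapping.lookup p k * q))" for x q
    by (simp add: laurent_act_def cj_def)
  fix x y q assume "x \<in> carrier ?K" "y \<in> carrier ?K"
  then have xy: "x \<in> N" "y \<in> N" "x \<in> carrier G" "y \<in> carrier G" by auto
  have cj: "cj k x \<in> N" "cj k y \<in> N" "cj k (x \<otimes>\<^bsub>?K\<^esub> y) = cj k x \<otimes>\<^bsub>?K\<^esub> cj k y" for k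
  proof -
    have "s [^]\<^bsub>G\<^esub> k \<otimes>\<^bsub>G\<^esub> (inv\<^bsub>G\<^esub> (s [^]\<^bsub>G\<^esub> k) \<otimes>\<^bsub>G\<^esub> v) = v" if "v \<in> carrier G" for v
      using assms(2) that by (simp add: m_assoc[symmetric])
    then show "cj k (x \<otimes>\<^bsub>?K\<^esub> y) = cj k x \<otimes>\<^bsub>?K\<^esub> cj k y"
      using xy assms(2) by (simp add: cj_def m_assoc)
  qed (use xy assms(2) in \<open>auto simp: cj_def inv_op_closed1\<close>)
  show "laurent_act G s p (Poly_Mapping.single y q) - laurent_act G s p (Poly_Mapping.single (x \<otimes>\<^bsub>?K\<^esub> y) q)
      + laurent_act G s p (Poly_Mapping.single x q) \<in> boundaries ?K"
    unfolding act sum_subtractf[symmetric] sum.distrib[symmetric] cj(3)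
    by (intro sum_in_boundaries single_in_boundaries) (simp_all add: cj)
qed

text \<open>For free rank zero, \<open>\<Delta>\<close> acts on the class of \<open>x\<close> as
  zero does. Applying the functional of \<open>\<tau>\<close> gives
  \<open>laurent_eval \<Delta> r * \<tau> x = 0\<close> for the eigenvalue \<open>r\<close> of the
  chosen \<open>s\<close>.\<close>

lemma alexander_polynomial_root:
  assumes "group G" and \<phi>: "\<phi> \<in> hom G integer_group" and "alexander_polynomial G \<phi> \<Delta>"
    and add: "\<And>x y. x \<in> kernel G integer_group \<phi> \<Longrightarrow> y \<in> kernel G integer_group \<phi> \<Longrightarrow>
      \<tau> (x \<otimes>\<^bsub>G\<^esub> y) = \<tau> x + (\<tau> y :: real)"
    and x: "x \<in> kernel G integer_group \<phi>" "\<tau> x \<noteq> 0"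
    and eigen: "\<And>s. s \<in> carrier G \<Longrightarrow> \<exists>r>0. \<forall>y\<in>kernel G integer_group \<phi>. \<forall>k::int.
      \<tau> (inv\<^bsub>G\<^esub> (s [^]\<^bsub>G\<^esub> k) \<otimes>\<^bsub>G\<^esub> y \<otimes>\<^bsub>G\<^esub> (s [^]\<^bsub>G\<^esub> k)) = r powi k * \<tau> y"
  shows "\<exists>r>0. laurent_eval \<Delta> r = 0"
proof -
  let ?N = "kernel G integer_group \<phi>" and ?K = "kernel_group G \<phi>"
  interpret \<phi>: group_hom G integer_group \<phi>
    by (intro group_hom.intro group_hom_axioms.intro assms(1) group_integer_group \<phi>)
  have normal: "?N \<lhd> G" by (rule \<phi>.normal_kernel)
  obtain s and f n :: nat and p where s: "s \<in> carrier G"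
    and iso: "module_isomorphic laurent_ring (alexander_module G \<phi> s)
      (module_sum (module_product {..<f} (\<lambda>_. laurent_regular))
        (module_product {..<n} (\<lambda>i. laurent_cyclic (p i))))"
    and \<Delta>: "\<Delta> = (if f = 0 then (\<Prod>i<n. p i) else 0)"
    using assms(3) unfolding alexander_polynomial_def by blast
  show ?thesis
  proof (cases "f = 0")
    case False
    \<comment> \<open>Here \<open>\<Delta>\<close> is zero, so any positive number is a
      root.\<close>
    then show ?thesis using \<Delta> by (intro exI[of _ 1]) (simp add: laurent_eval_def)
  next
    case True
    define M where "M = alexander_module G \<phi> s"
    define P where "P = module_sum (module_product {..<f} (\<lambda>_. laurent_regular))
        (module_product {..<n} (\<lambda>i. laurent_cyclic (p i)))"
    have R: "carrier laurent_ring = UNIV" by (simp add: ring_of_type_algebra_def)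
    obtain h where h: "bij_betw h (carrier M) (carrier P)"
      "\<And>q v. v \<in> carrier M \<Longrightarrow> h (q \<odot>\<^bsub>M\<^esub> v) = q \<odot>\<^bsub>P\<^esub> h v"
      using iso unfolding module_isomorphic_def M_def[symmetric] P_def[symmetric] R by blast
    have carrier_M: "carrier M = H1_class ?K ` {c. Poly_Mapping.keys c \<subseteq> ?N}"
      by (simp add: M_def alexander_module_def carrier_H1_group Let_def)
    have smult: "q \<odot>\<^bsub>M\<^esub> H1_class ?K c = H1_class ?K (laurent_act G s q c)" for q c
      unfolding M_def alexander_module_def Let_def
      by simp (rule the_elem_H1_class_image[where L = "laurent_act G s q", OF laurent_act_add
            laurent_act_boundaries[OF normal s]])
    have conj: "inv\<^bsub>G\<^esub> (s [^]\<^bsub>G\<^esub> (k::int)) \<otimes>\<^bsub>G\<^esub> y \<otimes>\<^bsub>G\<^esub> (s [^]\<^bsub>G\<^esub> k) \<in> ?N" if "y \<in> ?N" for y k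
      using normal.inv_op_closed1[OF normal _ that] s by auto
    define c :: "'a \<Rightarrow>\<^sub>0 rat" where "c = Poly_Mapping.single x 1"
    define u where "u = H1_class ?K c"
    have c: "Poly_Mapping.keys c \<subseteq> ?N" using x by (simp add: c_def)
    then have u: "u \<in> carrier M" by (auto simp: carrier_M u_def)
    \<comment> \<open>Injectivity of \<open>h\<close> is later applied to two multiples of
      \<open>u\<close>, which must lie in its domain.\<close>
    have closed: "q \<odot>\<^bsub>M\<^esub> u \<in> carrier M" for q
      unfolding u_def smult carrier_M by (intro imageI CollectI keys_laurent_act conj c)
    have "h u \<in> carrier P" using h(1) u by (auto simp: bij_betw_def)
    then obtain a b where ab: "h u = (a, b)" "\<And>i. i < n \<Longrightarrow> b i \<in> carrier (laurent_cyclic (p i))"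
      by (auto simp: P_def module_sum_def module_product_def PiE_iff)
    have "p i dvd \<Delta>" if "i < n" for i
      using that True by (simp add: \<Delta> dvd_prodI)
    then have "\<Delta> \<odot>\<^bsub>laurent_cyclic (p i)\<^esub> b i = 0 \<odot>\<^bsub>laurent_cyclic (p i)\<^esub> b i" if "i < n" for i
      using that ab(2) laurent_cyclic_annihilated by blast
    then have "\<Delta> \<odot>\<^bsub>P\<^esub> h u = 0 \<odot>\<^bsub>P\<^esub> h u"
      \<comment> \<open>The free summand is a product over the empty index set, on which all scalars
        act alike.\<close>
      using True by (simp add: ab(1) P_def module_sum_def module_product_def restrict_def fun_eq_iff)
    then have "h (\<Delta> \<odot>\<^bsub>M\<^esub> u) = h (0 \<odot>\<^bsub>M\<^esub> u)" by (simp only: h(2)[OF u])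
    then have "\<Delta> \<odot>\<^bsub>M\<^esub> u = 0 \<odot>\<^bsub>M\<^esub> u"
      using h(1) closed by (auto simp: bij_betw_def dest: inj_onD)
    then have eq: "H1_class ?K (laurent_act G s \<Delta> c) = H1_class ?K (laurent_act G s 0 c)"
      by (simp only: u_def smult)
    have "pair_chain \<tau> (laurent_act G s \<Delta> c) = pair_chain \<tau> (laurent_act G s 0 c)"
      by (rule pair_chain_H1_class[where G = ?K, OF _ eq]) (simp add: add)
    moreover obtain r where r: "r > 0" "\<And>y k. y \<in> ?N \<Longrightarrow>
        \<tau> (inv\<^bsub>G\<^esub> (s [^]\<^bsub>G\<^esub> (k::int)) \<otimes>\<^bsub>G\<^esub> y \<otimes>\<^bsub>G\<^esub> (s [^]\<^bsub>G\<^esub> k)) = r powi k * \<tau> y"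
      using eigen[OF s] by blast
    ultimately have "laurent_eval \<Delta> r * \<tau> x = laurent_eval 0 r * \<tau> x"
      using pair_chain_laurent_act[where K = ?N and \<tau> = \<tau>, OF r(2) c]
      by (simp add: c_def pair_chain_single)
    then show ?thesis using r(1) x(2) by (auto simp: laurent_eval_def)
  qed
qed

section \<open>The eigenfunctional of a bi-ordered HNN extension\<close>

lemma bi_ordered_hnn_eigenfunctional:
  fixes G :: "'h hnn_letter list set monoid" (structure)
    and A :: "('a, 'k) monoid_scheme" and H :: "('h, 'm) monoid_scheme" and \<iota>p \<iota>m :: "'a \<Rightarrow> 'h"
  defines "t \<equiv> hnn_stable A H \<iota>p \<iota>m" and "\<beta> \<equiv> hnn_base A H \<iota>p \<iota>m"
  assumes hnn: "group A" "group H" "\<iota>p \<in> hom A H" "\<iota>m \<in> hom A H"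
    and G: "G = hnn_extension A H \<iota>p \<iota>m"
    and fg: "finitely_generated_group H"
    and surj: "H1_map H \<iota>p ` carrier (H1_group A) = carrier (H1_group H)"
      "H1_map H \<iota>m ` carrier (H1_group A) = carrier (H1_group H)"
    and \<phi>: "\<phi> \<in> hom G integer_group" "\<phi> t = 1" "\<forall>h\<in>carrier H. \<phi> (\<beta> h) = 0"
    and nontriv: "kernel G integer_group \<phi> \<noteq> {\<one>}"
    and leq: "bi_ordering G leq"
  shows "\<exists>\<tau> :: _ \<Rightarrow> real.
    (\<forall>y\<in>kernel G integer_group \<phi>. \<forall>z\<in>kernel G integer_group \<phi>. \<tau> (y \<otimes> z) = \<tau> y + \<tau> z) \<and>
    (\<exists>y\<in>kernel G integer_group \<phi>. \<tau> y \<noteq> 0) \<and>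
    (\<forall>s\<in>carrier G. \<exists>r>0. \<forall>y\<in>kernel G integer_group \<phi>. \<forall>k::int.
      \<tau> (inv (s [^] k) \<otimes> y \<otimes> (s [^] k)) = r powi k * \<tau> y)"
proof -
  have group_G: "group G" unfolding G by (rule group_hnn_extension[OF hnn])
  interpret bi_ordered_group G leq
    by (intro bi_ordered_group.intro bi_ordered_group_axioms.intro group_G leq)
  interpret H: group H by (rule hnn(2))
  let ?N = "kernel G integer_group \<phi>"
  have t: "t \<in> carrier G" unfolding G t_def by (rule hnn_stable_carrier[OF hnn])
  have \<beta>: "\<beta> \<in> hom H G" unfolding G \<beta>_def by (rule hnn_base_hom[OF hnn])
  interpret \<beta>: group_hom H G \<beta>
    by (intro group_hom.intro group_hom_axioms.intro H.is_group group_G \<beta>)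
  interpret \<phi>: group_hom G integer_group \<phi>
    by (intro group_hom.intro group_hom_axioms.intro group_G group_integer_group \<phi>(1))
  have normal: "?N \<lhd> G" by (rule \<phi>.normal_kernel)
  have base_kernel: "\<beta> ` carrier H \<subseteq> ?N"
    using \<phi>(3) \<beta>.hom_closed by (auto simp: kernel_def)
  have rel: "inv t \<otimes> \<beta> (\<iota>p a) \<otimes> t = \<beta> (\<iota>m a)" if "a \<in> carrier A" for a
    unfolding G t_def \<beta>_def by (rule hnn_relation[OF hnn that])
  have ip_c: "\<iota>p a \<in> carrier H" and im_c: "\<iota>m a \<in> carrier H" if "a \<in> carrier A" for a
    using that hnn(3,4) by (auto simp: hom_def)
  have kernel_subset: "?N \<subseteq> N" if "subgroup N G" "N \<subseteq> ?N" "\<beta> ` carrier H \<subseteq> N"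
    "\<And>c. c \<in> N \<Longrightarrow> inv t \<otimes> c \<otimes> t \<in> N" "\<And>c. c \<in> N \<Longrightarrow> t \<otimes> c \<otimes> inv t \<in> N" for N
    using hnn_subgroup_contains_kernel[OF hnn, of \<phi> N] that G \<phi>(1,2) by (simp add: t_def \<beta>_def)

  obtain S where S: "finite S" "S \<subseteq> carrier H" "generate H S = carrier H"
    using fg by (auto simp: finitely_generated_group_def)
  have sub_base: "subgroup (\<beta> ` carrier H) G" by (rule \<beta>.img_is_subgroup)
  obtain x where x: "x \<in> \<beta> ` carrier H" "(\<one>, x) \<in> leq" "\<beta> ` S \<subseteq> convex_span x"
    using finite_subset_convex_span[of "\<beta> ` S" "\<beta> ` carrier H"] S sub_base by auto
  have xc: "x \<in> carrier G" using x le_carrier by auto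
  have base_span: "\<beta> ` carrier H \<subseteq> convex_span x"
    using generate_subgroup_incl[OF x(3) subgroup_convex_span[OF xc]] \<beta>.generate_img[OF S(2)] S(3) by simp
  have "x \<noteq> \<one>"
  proof
    \<comment> \<open>The base then has trivial image, so the trivial subgroup already satisfies the
      conditions of \<open>kernel_subset\<close>.\<close>
    assume "x = \<one>"
    then have "?N \<subseteq> {\<one>}"
      using base_span t by (intro kernel_subset triv_subgroup) (auto simp: convex_span_one kernel_def)
    then show False using nontriv subgroup.one_closed[OF \<phi>.subgroup_kernel] by blast
  qed
  note x_pos = x(2) this
  have add: "ratio x (y \<otimes> z) = ratio x y + ratio x z" if "y \<in> convex_span x" "z \<in> convex_span x" for y z
    by (rule ratio_mult[OF x_pos that])
  \<comment> \<open>The function \<open>ratio x\<close> composed with \<open>\<beta>\<close> is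
    additive on \<open>H\<close> and equals one at a preimage of \<open>x\<close>; this is why
    \<open>x\<close> was chosen in the image of the base.\<close>
  have detect: "\<exists>a\<in>carrier A. ratio x (\<beta> (\<iota> a)) \<noteq> 0"
    if "\<iota> \<in> hom A H" "H1_map H \<iota> ` carrier (H1_group A) = carrier (H1_group H)" for \<iota>
  proof -
    obtain h where "h \<in> carrier H" "x = \<beta> h" using x(1) by blast
    then show ?thesis
      using H1_surjective_detects[OF that, of "\<lambda>h. ratio x (\<beta> h)" h] base_span add ratio_self[OF x_pos]
      by (auto simp: image_subset_iff)
  qed
  \<comment> \<open>Conjugation by \<open>t\<close> carries the convex span of \<open>x\<close> onto
    that of \<open>x1\<close>. The next two facts show that these spans coincide, using
    \<open>\<iota>m\<close> for one inclusion and \<open>\<iota>p\<close> for the other.\<close>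
  define x1 where "x1 = inv t \<otimes> x \<otimes> t"
  have x1c: "x1 \<in> carrier G" using xc t by (simp add: x1_def)
  have x_x1: "x \<in> convex_span x1"
  proof -
    obtain a where a: "a \<in> carrier A" "ratio x (\<beta> (\<iota>m a)) \<noteq> 0" using detect[OF hnn(4) surj(2)] by blast
    then have "x \<in> convex_span (\<beta> (\<iota>m a))"
      using in_convex_span_if_ratio_nonzero[OF x_pos] base_span im_c by blast
    moreover have "\<beta> (\<iota>m a) \<in> convex_span x1"
      unfolding x1_def rel[OF a(1), symmetric] using base_span ip_c a by (intro conj_convex_span xc t) blast
    ultimately show ?thesis using convex_span_mono[OF x1c] by blast
  qed
  have x1_x: "x1 \<in> convex_span x"
  proof -
    obtain a where a: "a \<in> carrier A" "ratio x (\<beta> (\<iota>p a)) \<noteq> 0" using detect[OF hnn(3) surj(1)] by blast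
    then have "x \<in> convex_span (\<beta> (\<iota>p a))"
      using in_convex_span_if_ratio_nonzero[OF x_pos] base_span ip_c by blast
    then have "x1 \<in> convex_span (\<beta> (\<iota>m a))"
      unfolding x1_def rel[OF a(1), symmetric] using ip_c a by (intro conj_convex_span t) auto
    moreover have "\<beta> (\<iota>m a) \<in> convex_span x" using base_span im_c a by blast
    ultimately show ?thesis using convex_span_mono[OF xc] by blast
  qed
  \<comment> \<open>Intersecting with the kernel yields a subgroup on which \<open>\<phi>\<close>
    vanishes, as \<open>kernel_subset\<close> demands.\<close>
  have "?N \<subseteq> convex_span x \<inter> ?N"
  proof (rule kernel_subset)
    show "subgroup (convex_span x \<inter> ?N) G"
      by (intro subgroups_Inter_pair subgroup_convex_span xc \<phi>.subgroup_kernel)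
    fix c assume c: "c \<in> convex_span x \<inter> ?N"
    have "inv t \<otimes> c \<otimes> t \<in> convex_span x1" unfolding x1_def using c by (intro conj_convex_span xc t) auto
    then show "inv t \<otimes> c \<otimes> t \<in> convex_span x \<inter> ?N"
      using convex_span_mono[OF xc x1_x] normal.inv_op_closed1[OF normal t] c by blast
    have "c \<in> convex_span x1" using convex_span_mono[OF x1c x_x1] c by blast
    \<comment> \<open>Conjugation by the inverse of \<open>t\<close> takes \<open>x1\<close> back to
      \<open>x\<close>, which gives stability in the second direction.\<close>
    then have "inv (inv t) \<otimes> c \<otimes> inv t \<in> convex_span (inv (inv t) \<otimes> x1 \<otimes> inv t)"
      using t by (intro conj_convex_span x1c) auto
    moreover have "t \<otimes> x1 \<otimes> inv t = (t \<otimes> inv t) \<otimes> x \<otimes> (t \<otimes> inv t)"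
      unfolding x1_def using t xc by (simp only: m_assoc m_closed inv_closed)
    ultimately show "t \<otimes> c \<otimes> inv t \<in> convex_span x \<inter> ?N"
      using normal.inv_op_closed2[OF normal t] c t xc by auto
  qed (use base_span base_kernel in auto)
  then have N_span: "?N \<subseteq> convex_span x" by blast
  have xN: "x \<in> ?N" using x(1) base_kernel by blast
  have "ratio x x \<noteq> 0" using ratio_self[OF x_pos] by simp
  then show ?thesis
    using N_span add xN ratio_conj_int_pow[OF x_pos normal xN N_span]
    by (intro exI[of _ "ratio x"]) blast
qed

theorem theorem4:
  fixes A :: "('a, 'k) monoid_scheme"
    and H :: "('h, 'm) monoid_scheme"
    and \<iota>p \<iota>m :: "'a \<Rightarrow> 'h"
    and G :: "'h hnn_letter list set monoid"
    and \<phi> :: "'h hnn_letter list set \<Rightarrow> int"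
    and \<Delta> :: laurent
  assumes "group H" and "finitely_generated_group H"
    and "group A"
    and "\<iota>p \<in> hom A H" and "\<iota>m \<in> hom A H"
    and "H1_map H \<iota>p ` carrier (H1_group A) = carrier (H1_group H)"
    and "H1_map H \<iota>m ` carrier (H1_group A) = carrier (H1_group H)"
    and "G = hnn_extension A H \<iota>p \<iota>m"
    and "finitely_generated_group G"
    and "\<phi> \<in> hom G integer_group"
    and "\<phi> (hnn_stable A H \<iota>p \<iota>m) = 1"
    and "\<forall>h\<in>carrier H. \<phi> (hnn_base A H \<iota>p \<iota>m h) = 0"
    and "kernel G integer_group \<phi> \<noteq> {\<one>\<^bsub>G\<^esub>}"
    and "alexander_polynomial G \<phi> \<Delta>"
    and "\<not> (\<exists>x>0. laurent_eval \<Delta> x = 0)"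
  shows "\<not> bi_orderable G"
proof
  assume "bi_orderable G"
  then obtain leq where leq: "bi_ordering G leq" by (auto simp: bi_orderable_def)
  have "group G" unfolding assms(8) by (rule group_hnn_extension[OF assms(3,1,4,5)])
  moreover obtain \<tau> :: "'h hnn_letter list set \<Rightarrow> real" and x where
    "\<And>y z. y \<in> kernel G integer_group \<phi> \<Longrightarrow> z \<in> kernel G integer_group \<phi> \<Longrightarrow>
      \<tau> (y \<otimes>\<^bsub>G\<^esub> z) = \<tau> y + \<tau> z"
    "x \<in> kernel G integer_group \<phi>" "\<tau> x \<noteq> 0"
    "\<And>s. s \<in> carrier G \<Longrightarrow> \<exists>r>0. \<forall>y\<in>kernel G integer_group \<phi>. \<forall>k::int.
      \<tau> (inv\<^bsub>G\<^esub> (s [^]\<^bsub>G\<^esub> k) \<otimes>\<^bsub>G\<^esub> y \<otimes>\<^bsub>G\<^esub> (s [^]\<^bsub>G\<^esub> k)) = r powi k * \<tau> y"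
    using bi_ordered_hnn_eigenfunctional[OF assms(3,1,4,5,8,2,6,7,10-13) leq] by metis
  ultimately have "\<exists>r>0. laurent_eval \<Delta> r = 0"
    using alexander_polynomial_root[OF _ assms(10,14)] by blast
  with assms(15) show False by blast
qed

end
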